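(* 1. Let $I$ be an ideal of the Lie algebra $\mathfrak{u}_\infty$. Then $\mathfrak{u}_\infty/I\simeq\mathfrak{u}_\infty$ if and only if $I=0$. 2. Let $I$ and $J$ be nonzero ideals of $\mathfrak{u}_\infty$ and let $n=\min\{n'\ge 2\mid\mathfrak{u}_{\infty,n'+1}\subseteq I,\ \mathfrak{u}_{\infty,n'+1}\subseteq J\}$ (which is finite). Then $\mathfrak{u}_\infty/I\simeq\mathfrak{u}_\infty/J$ if and only if $\mathfrak{u}_n/I'\simeq\mathfrak{u}_n/J'$, where $I'=I/\mathfrak{u}_{\infty,n+1}$ and $J'=J/\mathfrak{u}_{\infty,n+1}$ are regarded as ideals of $\mathfrak{u}_n=\mathfrak{u}_\infty/\mathfrak{u}_{\infty,n+1}$.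
   Context: $K$ is a field of characteristic zero, $P_0=K$, $P_i=K[x_1,\ldots,x_i]$, $\partial_i=\partial/\partial x_i$. For $n\ge 2$, $\mathfrak{u}_n=K\partial_1+P_1\partial_2+\cdots+P_{n-1}\partial_n$, a Lie subalgebra of $\mathrm{Der}_K(P_n)$; $\mathfrak{u}_\infty=\bigcup_{n\ge 2}\mathfrak{u}_n=\bigoplus_{i\ge 1}P_{i-1}\partial_i$. For $n\ge 1$, $\mathfrak{u}_{\infty,n}=\bigoplus_{j\ge n}P_{j-1}\partial_j$, an ideal of $\mathfrak{u}_\infty$; the composition $\mathfrak{u}_n\subset\mathfrak{u}_\infty\to\mathfrak{u}_\infty/\mathfrak{u}_{\infty,n+1}$ is an isomorphism of Lie algebras, used to identify $\mathfrak{u}_n$ with $\mathfrak{u}_\infty/\mathfrak{u}_{\infty,n+1}$. All isomorphisms are isomorphisms of Lie algebras over $K$. *)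

theory Defs
  imports "HOL-Library.Poly_Mapping" "HOL-Algebra.Congruence"
begin

section \<open>Lie algebras, ideals, quotients, isomorphisms\<close>

record ('k, 'v) lie_alg = "'v partial_object" +
  ladd :: "'v \<Rightarrow> 'v \<Rightarrow> 'v"
  lzero :: 'v
  lscale :: "'k \<Rightarrow> 'v \<Rightarrow> 'v"
  lbracket :: "'v \<Rightarrow> 'v \<Rightarrow> 'v"

locale lie_algebra =
  fixes L :: "('k::field, 'v) lie_alg"
  assumes add_closed: "x \<in> carrier L \<Longrightarrow> y \<in> carrier L \<Longrightarrow> ladd L x y \<in> carrier L"
    and zero_closed: "lzero L \<in> carrier L"
    and scale_closed: "x \<in> carrier L \<Longrightarrow> lscale L c x \<in> carrier L"
    and bracket_closed: "x \<in> carrier L \<Longrightarrow> y \<in> carrier L \<Longrightarrow> lbracket L x y \<in> carrier L"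
    and add_assoc: "x \<in> carrier L \<Longrightarrow> y \<in> carrier L \<Longrightarrow> z \<in> carrier L \<Longrightarrow>
      ladd L (ladd L x y) z = ladd L x (ladd L y z)"
    and add_commute: "x \<in> carrier L \<Longrightarrow> y \<in> carrier L \<Longrightarrow> ladd L x y = ladd L y x"
    and zero_add: "x \<in> carrier L \<Longrightarrow> ladd L (lzero L) x = x"
    and add_inverse: "x \<in> carrier L \<Longrightarrow> ladd L (lscale L (- 1) x) x = lzero L"
    and scale_one: "x \<in> carrier L \<Longrightarrow> lscale L 1 x = x"
    and scale_scale: "x \<in> carrier L \<Longrightarrow> lscale L c (lscale L d x) = lscale L (c * d) x"
    and scale_add_left: "x \<in> carrier L \<Longrightarrow>
      lscale L (c + d) x = ladd L (lscale L c x) (lscale L d x)"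
    and scale_add_right: "x \<in> carrier L \<Longrightarrow> y \<in> carrier L \<Longrightarrow>
      lscale L c (ladd L x y) = ladd L (lscale L c x) (lscale L c y)"
    and bracket_add_left: "x \<in> carrier L \<Longrightarrow> y \<in> carrier L \<Longrightarrow> z \<in> carrier L \<Longrightarrow>
      lbracket L (ladd L x y) z = ladd L (lbracket L x z) (lbracket L y z)"
    and bracket_add_right: "x \<in> carrier L \<Longrightarrow> y \<in> carrier L \<Longrightarrow> z \<in> carrier L \<Longrightarrow>
      lbracket L x (ladd L y z) = ladd L (lbracket L x y) (lbracket L x z)"
    and bracket_scale_left: "x \<in> carrier L \<Longrightarrow> y \<in> carrier L \<Longrightarrow>
      lbracket L (lscale L c x) y = lscale L c (lbracket L x y)"
    and bracket_scale_right: "x \<in> carrier L \<Longrightarrow> y \<in> carrier L \<Longrightarrow>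
      lbracket L x (lscale L c y) = lscale L c (lbracket L x y)"
    and bracket_self: "x \<in> carrier L \<Longrightarrow> lbracket L x x = lzero L"
    and jacobi: "x \<in> carrier L \<Longrightarrow> y \<in> carrier L \<Longrightarrow> z \<in> carrier L \<Longrightarrow>
      ladd L (lbracket L x (lbracket L y z))
        (ladd L (lbracket L y (lbracket L z x)) (lbracket L z (lbracket L x y))) = lzero L"

definition lie_ideal :: "('k::field, 'v) lie_alg \<Rightarrow> 'v set \<Rightarrow> bool" where
  "lie_ideal L I \<longleftrightarrow> I \<subseteq> carrier L \<and> lzero L \<in> I \<and>
     (\<forall>x\<in>I. \<forall>y\<in>I. ladd L x y \<in> I) \<and> (\<forall>c. \<forall>x\<in>I. lscale L c x \<in> I) \<and>
     (\<forall>x\<in>carrier L. \<forall>y\<in>I. lbracket L x y \<in> I)"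

definition lie_coset :: "('k, 'v) lie_alg \<Rightarrow> 'v set \<Rightarrow> 'v \<Rightarrow> 'v set" where
  "lie_coset L I x = {ladd L x i | i. i \<in> I}"

text \<open>The operations on cosets are \<open>(x + I) + (y + I) = (x + y) + I\<close> etc.; the union over all
  representatives avoids choosing them (for an ideal \<open>I\<close>, all the sets in the union coincide,
  see \<open>quot_add\<close>, \<open>quot_scale\<close>, \<open>quot_bracket\<close> below).\<close>

definition lie_quot :: "('k, 'v) lie_alg \<Rightarrow> 'v set \<Rightarrow> ('k, 'v set) lie_alg" where
  "lie_quot L I = \<lparr> carrier = lie_coset L I ` carrier L,
     ladd = (\<lambda>A B. \<Union>x\<in>A. \<Union>y\<in>B. lie_coset L I (ladd L x y)),
     lzero = I,
     lscale = (\<lambda>c A. \<Union>x\<in>A. lie_coset L I (lscale L c x)),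
     lbracket = (\<lambda>A B. \<Union>x\<in>A. \<Union>y\<in>B. lie_coset L I (lbracket L x y)) \<rparr>"

definition lie_iso :: "('k, 'v) lie_alg \<Rightarrow> ('k, 'w) lie_alg \<Rightarrow> ('v \<Rightarrow> 'w) \<Rightarrow> bool" where
  "lie_iso L M f \<longleftrightarrow> bij_betw f (carrier L) (carrier M) \<and>
     (\<forall>x\<in>carrier L. \<forall>y\<in>carrier L. f (ladd L x y) = ladd M (f x) (f y)) \<and>
     (\<forall>c. \<forall>x\<in>carrier L. f (lscale L c x) = lscale M c (f x)) \<and>
     (\<forall>x\<in>carrier L. \<forall>y\<in>carrier L. f (lbracket L x y) = lbracket M (f x) (f y))"

definition lie_isomorphic :: "('k, 'v) lie_alg \<Rightarrow> ('k, 'w) lie_alg \<Rightarrow> bool" (infix "\<simeq>\<^sub>L" 50) where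
  "L \<simeq>\<^sub>L M \<longleftrightarrow> (\<exists>f. lie_iso L M f)"


section \<open>Polynomials and derivations\<close>

text \<open>\<open>'k pol\<close> is the polynomial ring in the countably many variables \<open>x\<^sub>1, x\<^sub>2, \<dots>\<close>, the union of
  all the \<open>P\<^sub>n\<close>. An exponent vector stores the exponent of \<open>x\<^sub>i\<close> at index \<open>i - 1\<close>, so that every
  index is in use; \<open>var\<close> and \<open>pd\<close> are only applied to indices \<open>i \<ge> 1\<close>.\<close>

type_synonym 'k pol = "(nat \<Rightarrow>\<^sub>0 nat) \<Rightarrow>\<^sub>0 'k"

definition const :: "'k::field \<Rightarrow> 'k pol" where
  "const c = Poly_Mapping.single 0 c"

definition var :: "nat \<Rightarrow> 'k::field pol" where
  "var i = Poly_Mapping.single (Poly_Mapping.single (i - 1) 1) 1"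

definition Pol :: "nat \<Rightarrow> 'k::field pol set" where
  "Pol n = {p. \<forall>m\<in>Poly_Mapping.keys p. Poly_Mapping.keys m \<subseteq> {..<n}}"

definition pd :: "nat \<Rightarrow> 'k::field pol \<Rightarrow> 'k pol" where
  "pd i p = (\<Sum>m\<in>Poly_Mapping.keys p. Poly_Mapping.single (m - Poly_Mapping.single (i - 1) 1)
     (of_nat (Poly_Mapping.lookup m (i - 1)) * Poly_Mapping.lookup p m))"

definition derivations :: "('k::field pol \<Rightarrow> 'k pol) set" where
  "derivations = {D. (\<forall>f g. D (f + g) = D f + D g) \<and> (\<forall>c f. D (const c * f) = const c * D f) \<and>
     (\<forall>f g. D (f * g) = D f * g + f * D g)}"

definition Der :: "('k::field, 'k pol \<Rightarrow> 'k pol) lie_alg" where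
  "Der = \<lparr> carrier = derivations,
     ladd = (\<lambda>D E f. D f + E f),
     lzero = (\<lambda>f. 0),
     lscale = (\<lambda>c D f. const c * D f),
     lbracket = (\<lambda>D E f. D (E f) - E (D f)) \<rparr>"


section \<open>Triangular derivations\<close>

text \<open>\<open>tri m n\<close> is \<open>P\<^bsub>m-1\<^esub>\<partial>\<^sub>m + \<dots> + P\<^bsub>n-1\<^esub>\<partial>\<^sub>n\<close>. A derivation \<open>\<Sum>\<^sub>i\<^sub>\<le>\<^sub>n p\<^sub>i\<partial>\<^sub>i\<close> of \<open>P\<^sub>n\<close>
  is represented by the derivation of \<^typ>\<open>'k pol\<close> given by the same formula; this is the
  identification under which \<open>u\<^sub>n \<subseteq> u\<^bsub>n+1\<^esub>\<close> and the union of the \<open>u\<^sub>n\<close> makes sense.\<close>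

definition tri :: "nat \<Rightarrow> nat \<Rightarrow> ('k::field pol \<Rightarrow> 'k pol) set" where
  "tri m n = {\<lambda>f. \<Sum>i=m..n. p i * pd i f | p. \<forall>i\<in>{m..n}. p i \<in> Pol (i - 1)}"

definition u_fin :: "nat \<Rightarrow> ('k::field, 'k pol \<Rightarrow> 'k pol) lie_alg" where
  "u_fin n = Der \<lparr> carrier := tri 1 n \<rparr>"

definition u_inf :: "('k::field, 'k pol \<Rightarrow> 'k pol) lie_alg" where
  "u_inf = Der \<lparr> carrier := (\<Union>n\<in>{2..}. carrier (u_fin n)) \<rparr>"

text \<open>The ideal \<open>u\<^bsub>\<infinity>,n\<^esub>\<close>, for \<open>n \<ge> 1\<close>.\<close>

definition u_inf_ge :: "nat \<Rightarrow> ('k::field pol \<Rightarrow> 'k pol) set" where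
  "u_inf_ge n = (\<Union>m. tri n m)"

text \<open>The identification \<open>u\<^sub>n \<subseteq> u\<^sub>\<infinity> \<rightarrow> u\<^sub>\<infinity> / u\<^bsub>\<infinity>,n+1\<^esub>\<close>; see \<open>lie_iso_u_ident\<close> below.\<close>

definition u_ident :: "nat \<Rightarrow> ('k::field pol \<Rightarrow> 'k pol) \<Rightarrow> ('k pol \<Rightarrow> 'k pol) set" where
  "u_ident n D = lie_coset u_inf (u_inf_ge (n + 1)) D"

text \<open>\<open>I / u\<^bsub>\<infinity>,n+1\<^esub>\<close>, an ideal of \<open>u\<^sub>\<infinity> / u\<^bsub>\<infinity>,n+1\<^esub>\<close>, transported to \<open>u\<^sub>n\<close> along \<^const>\<open>u_ident\<close>.\<close>

definition reduced_ideal ::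
    "nat \<Rightarrow> ('k::field pol \<Rightarrow> 'k pol) set \<Rightarrow> ('k pol \<Rightarrow> 'k pol) set" where
  "reduced_ideal n I =
     {D \<in> carrier (u_fin n). u_ident n D \<in> lie_coset u_inf (u_inf_ge (n + 1)) ` I}"



section \<open>Basic facts\<close>

abbreviation xexp :: "nat \<Rightarrow> nat \<Rightarrow>\<^sub>0 nat" where
  "xexp i \<equiv> Poly_Mapping.single (i - 1) 1"

lemma lookup_pd:
  "Poly_Mapping.lookup (pd i p) m = of_nat (Poly_Mapping.lookup m (i - 1) + 1) * Poly_Mapping.lookup p (m + xexp i)"
proof -
  have eq: "(Poly_Mapping.lookup (Poly_Mapping.single (m' - xexp i)
              (of_nat (Poly_Mapping.lookup m' (i - 1)) * Poly_Mapping.lookup p m')) m) =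
        (if m' = m + xexp i then of_nat (Poly_Mapping.lookup m' (i - 1)) * Poly_Mapping.lookup p m' else 0)" for m'
  proof (cases "Poly_Mapping.lookup m' (i - 1) = 0")
    case True
    moreover have "m' \<noteq> m + xexp i"
      using True by (auto simp: lookup_add)
    ultimately show ?thesis by simp
  next
    case False
    then have "m' - xexp i + xexp i = m'"
      by (intro poly_mapping_eqI) (auto simp: lookup_add lookup_minus lookup_single when_def)
    then have "m' - xexp i = m \<longleftrightarrow> m' = m + xexp i"
      by (metis add_right_cancel)
    then show ?thesis by (auto simp: lookup_single when_def)
  qed
  have "Poly_Mapping.lookup (pd i p) m = (\<Sum>m'\<in>Poly_Mapping.keys p. 
     (if m' = m + xexp i then of_nat (Poly_Mapping.lookup m' (i - 1)) * Poly_Mapping.lookup p m' else 0))"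
    unfolding pd_def lookup_sum eq ..
  also have "\<dots> = of_nat (Poly_Mapping.lookup (m + xexp i) (i - 1)) * Poly_Mapping.lookup p (m + xexp i)"
    by (simp add: sum.delta in_keys_iff)
  finally show ?thesis by (simp add: lookup_add)
qed

lemma pd_add: "pd i (f + g) = pd i f + pd i g"
  by (rule poly_mapping_eqI) (simp add: lookup_pd lookup_add algebra_simps)

lemma pd_0 [simp]: "pd i 0 = 0"
  by (rule poly_mapping_eqI) (simp add: lookup_pd)

lemma pd_sum: "pd i (sum f A) = (\<Sum>x\<in>A. pd i (f x))"
  by (induction A rule: infinite_finite_induct) (auto simp: pd_add)

lemma pd_single:
  "pd i (Poly_Mapping.single m c) =
    Poly_Mapping.single (m - xexp i) (of_nat (Poly_Mapping.lookup m (i - 1)) * c)"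
  by (simp add: pd_def)

lemma poly_eq_sum_single:
  "p = (\<Sum>m\<in>Poly_Mapping.keys p. Poly_Mapping.single m (Poly_Mapping.lookup p m))"
  by (rule poly_mapping_eqI)
     (simp add: lookup_sum lookup_single when_def sum.delta in_keys_iff)

lemma single_pd_aux:
  "Poly_Mapping.single (m - xexp i) (of_nat (Poly_Mapping.lookup m (i - 1)) * c) * Poly_Mapping.single m' d =
   Poly_Mapping.single (m + m' - xexp i) (of_nat (Poly_Mapping.lookup m (i - 1)) * c * (d::'k::field))"
proof (cases "Poly_Mapping.lookup m (i - 1) = 0")
  case False
  then have "m - xexp i + m' = m + m' - xexp i"
    by (intro poly_mapping_eqI) (auto simp: lookup_add lookup_minus lookup_single when_def)
  then show ?thesis by (simp add: mult_single)
qed simp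

lemma pd_mult: "pd i (f * g) = pd i f * g + f * pd i (g :: 'k::field pol)"
proof -
  have ss: "pd i (Poly_Mapping.single m c * Poly_Mapping.single m' d) =
     pd i (Poly_Mapping.single m c) * Poly_Mapping.single m' d +
     Poly_Mapping.single m c * pd i (Poly_Mapping.single m' (d::'k))" for m m' c d
  proof -
    have "Poly_Mapping.single m c * pd i (Poly_Mapping.single m' (d::'k)) =
      pd i (Poly_Mapping.single m' d) * Poly_Mapping.single m c" by (simp add: mult.commute)
    then show ?thesis
      using single_pd_aux[of m i c m' d] single_pd_aux[of m' i d m c]
      by (simp add: mult_single pd_single lookup_add algebra_simps flip: single_add)
  qed
  have s: "pd i (Poly_Mapping.single m c * g) =
     pd i (Poly_Mapping.single m c) * g + Poly_Mapping.single m c * pd i g" for m c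
    by (subst (1 2 3) poly_eq_sum_single[of g])
       (simp add: sum_distrib_left sum_distrib_right pd_sum ss sum.distrib)
  show ?thesis
    by (subst (1 2 3) poly_eq_sum_single[of f])
       (simp add: sum_distrib_left sum_distrib_right pd_sum s sum.distrib)
qed

lemma pd_const [simp]: "pd i (const c) = 0"
  by (simp add: const_def pd_single)

lemma pd_var: "i \<ge> 1 \<Longrightarrow> j \<ge> 1 \<Longrightarrow> pd i (var j) = (if i = j then 1 else 0)"
  by (auto simp: var_def pd_single lookup_single when_def)

lemma pd_commute: "pd i (pd j f) = pd j (pd i f)"
proof (cases "i - 1 = j - 1")
  case True
  then show ?thesis by (simp add: pd_def)
next
  case False
  then show ?thesis
    by (intro poly_mapping_eqI)
       (auto simp: lookup_pd lookup_add lookup_single when_def algebra_simps)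
qed

lemma const_mult: "const (c * d) = const c * const d" and const_1: "const 1 = 1"
  and const_add: "const (c + d) = const c + const d"
  and const_uminus: "const (- c) = - const c"
  by (simp_all add: const_def mult_single single_add single_uminus)

subsection \<open>The polynomial rings\<close>

lemma Pol_0: "0 \<in> Pol n" and Pol_const: "const c \<in> Pol n"
  by (auto simp: Pol_def const_def)

lemma Pol_add: "f \<in> Pol n \<Longrightarrow> g \<in> Pol n \<Longrightarrow> f + g \<in> Pol n"
  using Poly_Mapping.keys_add[of f g] by (fastforce simp: Pol_def)

lemma Pol_uminus: "f \<in> Pol n \<Longrightarrow> - f \<in> Pol n"
  by (auto simp: Pol_def in_keys_iff)

lemma Pol_diff: "f \<in> Pol n \<Longrightarrow> g \<in> Pol n \<Longrightarrow> f - g \<in> Pol n"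
  using Pol_add[of f n "- g"] Pol_uminus[of g n] by simp

lemma Pol_mult: "f \<in> Pol n \<Longrightarrow> g \<in> Pol n \<Longrightarrow> f * g \<in> Pol n"
proof -
  assume f: "f \<in> Pol n" and g: "g \<in> Pol n"
  have "Poly_Mapping.keys m \<subseteq> {..<n}" if m: "m \<in> Poly_Mapping.keys (f * g)" for m
  proof -
    obtain a b where "m = a + b" "a \<in> Poly_Mapping.keys f" "b \<in> Poly_Mapping.keys g"
      using m Poly_Mapping.keys_mult[of f g] by blast
    then show ?thesis
      using f g Poly_Mapping.keys_add[of a b] unfolding Pol_def by blast
  qed
  then show ?thesis by (simp add: Pol_def)
qed

lemma Pol_sum: "(\<And>x. x \<in> A \<Longrightarrow> f x \<in> Pol n) \<Longrightarrow> sum f A \<in> Pol n"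
  by (induction A rule: infinite_finite_induct) (auto simp: Pol_0 Pol_add)

lemma Pol_mono: "m \<le> n \<Longrightarrow> f \<in> Pol m \<Longrightarrow> f \<in> Pol n"
  unfolding Pol_def by fastforce

lemma Pol_var: "1 \<le> i \<Longrightarrow> i \<le> n \<Longrightarrow> var i \<in> Pol n"
  by (auto simp: Pol_def var_def)

lemma Pol_zero: "Pol 0 = range const"
proof -
  have "p = const (Poly_Mapping.lookup p 0)" if "p \<in> Pol 0" for p :: "'a pol"
  proof (rule poly_mapping_eqI)
    fix m
    have "m \<in> Poly_Mapping.keys p \<Longrightarrow> m = 0" using that by (auto simp: Pol_def)
    then show "Poly_Mapping.lookup p m = Poly_Mapping.lookup (const (Poly_Mapping.lookup p 0)) m"
      by (auto simp: const_def lookup_single when_def in_keys_iff)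
  qed
  then show ?thesis by (auto simp: Pol_const)
qed

lemma Pol_UN: "(\<Union>n. Pol n) = UNIV"
proof -
  have "\<exists>n. f \<in> Pol n" for f :: "'a pol"
  proof -
    have "finite (\<Union>m\<in>Poly_Mapping.keys f. Poly_Mapping.keys m)" by auto
    then obtain n where "\<forall>i\<in>(\<Union>m\<in>Poly_Mapping.keys f. Poly_Mapping.keys m). i < n"
      by (auto simp only: finite_nat_set_iff_bounded)
    then show ?thesis by (auto simp: Pol_def)
  qed
  then show ?thesis by auto
qed

lemma Pol_pd: "f \<in> Pol n \<Longrightarrow> pd i f \<in> Pol n"
proof -
  assume f: "f \<in> Pol n"
  have "Poly_Mapping.keys m \<subseteq> {..<n}" if "m \<in> Poly_Mapping.keys (pd i f)" for m
  proof -
    have "m + xexp i \<in> Poly_Mapping.keys f" using that by (auto simp: in_keys_iff lookup_pd)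
    then have "Poly_Mapping.keys (m + xexp i) \<subseteq> {..<n}" using f by (auto simp: Pol_def)
    moreover have "Poly_Mapping.keys m \<subseteq> Poly_Mapping.keys (m + xexp i)"
      by (auto simp: in_keys_iff lookup_add)
    ultimately show ?thesis by blast
  qed
  then show ?thesis by (simp add: Pol_def)
qed

lemma pd_eq_0: "f \<in> Pol n \<Longrightarrow> n < i \<Longrightarrow> pd i f = 0"
proof (rule poly_mapping_eqI)
  fix m assume f: "f \<in> Pol n" and i: "n < i"
  have "i - 1 \<in> Poly_Mapping.keys (m + xexp i)" by (simp add: in_keys_iff lookup_add)
  then have "m + xexp i \<notin> Poly_Mapping.keys f" using f i by (fastforce simp: Pol_def)
  then show "Poly_Mapping.lookup (pd i f) m = Poly_Mapping.lookup 0 m"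
    by (simp add: lookup_pd in_keys_iff)
qed

subsection \<open>Lie algebras of derivations\<close>

lemma derivationsD:
  assumes "D \<in> derivations"
  shows "D (f + g) = D f + D g" "D (const c * f) = const c * D f" "D (f * g) = D f * g + f * D g"
    "D 0 = 0" "D (- f) = - D f" "D (f - g) = D f - D g" "D (const c) = 0"
proof -
  show 1: "D (f + g) = D f + D g" for f g using assms unfolding derivations_def by blast
  have c: "D (const c * h) = const c * D h" "D (h * k) = D h * k + h * D k" for h k
    using assms unfolding derivations_def by blast+
  show "D (const c * f) = const c * D f" "D (f * g) = D f * g + f * D g" by (fact c)+
  have "D 1 = D 1 + D 1" using c(2)[of 1 1] by (simp only: mult_1_left mult_1_right)
  then have "D 1 = 0" by (rule iffD1[OF add_cancel_right_right])
  then show "D (const c) = 0" using c(1)[of 1] by simp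
  have "D 0 = D 0 + D 0" using 1[of 0 0] by (simp only: add_0_left)
  then show 2: "D 0 = 0" by (rule iffD1[OF add_cancel_right_right])
  show 3: "D (- f) = - D f" for f using 1[of f "- f"] 2 by (simp add: eq_neg_iff_add_eq_0 add.commute)
  show "D (f - g) = D f - D g" using 1[of f "- g"] 3[of g] by simp
qed

lemma lie_algebra_Der: "lie_algebra Der"
proof -
  have "(\<lambda>f. D f + E f) \<in> derivations" "(\<lambda>f. const c * D f) \<in> derivations"
    "(\<lambda>f. D (E f) - E (D f)) \<in> derivations"
    if "D \<in> derivations" "E \<in> derivations" for D E :: "'a pol \<Rightarrow> 'a pol" and c
    unfolding derivations_def using that by (auto simp: derivationsD algebra_simps)
  moreover have "(\<lambda>f. 0 :: 'a pol) \<in> derivations" by (simp add: derivations_def)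
  ultimately show ?thesis
    by unfold_locales
      (auto simp: Der_def derivationsD const_add const_mult const_1 const_uminus fun_eq_iff algebra_simps)
qed

lemma tri_subset_derivations: "tri m n \<subseteq> derivations"
proof -
  have "(\<lambda>f. \<Sum>i=m..n. p i * pd i f) \<in> derivations" for p :: "nat \<Rightarrow> 'a pol"
    by (simp add: derivations_def pd_add pd_mult sum.distrib sum_distrib_left sum_distrib_right algebra_simps)
  then show ?thesis by (auto simp: tri_def)
qed

lemma triI: "(\<And>i. i \<in> {m..n} \<Longrightarrow> p i \<in> Pol (i - 1)) \<Longrightarrow> D = (\<lambda>f. \<Sum>i=m..n. p i * pd i f) \<Longrightarrow> D \<in> tri m n"
  unfolding tri_def by blast

lemma triE:
  assumes "D \<in> tri m n"
  obtains p where "\<And>i. p i \<in> Pol (i - 1)" "\<And>i. i \<notin> {m..n} \<Longrightarrow> p i = 0"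
    "D = (\<lambda>f. \<Sum>i=m..n. p i * pd i f)"
proof -
  obtain q where q: "\<forall>i\<in>{m..n}. q i \<in> Pol (i - 1)" "D = (\<lambda>f. \<Sum>i=m..n. q i * pd i f)"
    using assms unfolding tri_def by blast
  show ?thesis
    by (rule that[of "\<lambda>i. if i \<in> {m..n} then q i else 0"])
       (use q in \<open>auto simp: Pol_0 fun_eq_iff intro!: sum.cong\<close>)
qed

lemma tri_mono: assumes "m' \<le> m" "n \<le> n'" shows "tri m n \<subseteq> tri m' n'"
proof
  fix D :: "'a pol \<Rightarrow> _" assume "D \<in> tri m n"
  then obtain p where p: "\<And>i. p i \<in> Pol (i - 1)" "\<And>i. i \<notin> {m..n} \<Longrightarrow> p i = 0"
    "D = (\<lambda>f. \<Sum>i=m..n. p i * pd i f)" by (erule triE)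
  show "D \<in> tri m' n'"
    by (rule triI[of m' n' p])
       (use p assms in \<open>auto simp: fun_eq_iff intro!: sum.mono_neutral_left\<close>)
qed

lemma tri_add: "D \<in> tri m n \<Longrightarrow> E \<in> tri m n \<Longrightarrow> (\<lambda>f. D f + E f) \<in> tri m n"
proof -
  assume "D \<in> tri m n" "E \<in> tri m n"
  then obtain p q where "\<And>i. p i \<in> Pol (i - 1)" "\<And>i. q i \<in> Pol (i - 1)"
    "D = (\<lambda>f. \<Sum>i=m..n. p i * pd i f)" "E = (\<lambda>f. \<Sum>i=m..n. q i * pd i f)"
    by (elim triE) blast
  then show ?thesis
    by (intro triI[of m n "\<lambda>i. p i + q i"]) (auto simp: Pol_add sum.distrib algebra_simps)
qed

lemma tri_scale: "D \<in> tri m n \<Longrightarrow> (\<lambda>f. const c * D f) \<in> tri m n"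
proof -
  assume "D \<in> tri m n"
  then obtain p where "\<And>i. p i \<in> Pol (i - 1)" "D = (\<lambda>f. \<Sum>i=m..n. p i * pd i f)"
    by (elim triE) blast
  then show ?thesis
    by (intro triI[of m n "\<lambda>i. const c * p i"])
       (auto simp: Pol_mult Pol_const sum_distrib_left algebra_simps)
qed

lemma tri_0: "(\<lambda>f. 0) \<in> tri m n"
  by (rule triI[of m n "\<lambda>i. 0"]) (auto simp: Pol_0)

lemma tri_Pol: assumes "D \<in> tri m n" "f \<in> Pol k" shows "D f \<in> Pol k"
proof -
  obtain p where p: "\<And>i. p i \<in> Pol (i - 1)" "D = (\<lambda>f. \<Sum>i=m..n. p i * pd i f)"
    using assms(1) by (elim triE) blast
  have "p i * pd i f \<in> Pol k" for i
  proof (cases "i \<le> k")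
    case True
    then show ?thesis using p(1)[of i] assms(2)
      by (intro Pol_mult Pol_pd) (auto intro: Pol_mono[rotated])
  next
    case False
    then show ?thesis using pd_eq_0[OF assms(2), of i] by (simp add: Pol_0)
  qed
  then show ?thesis by (auto simp: p(2) intro: Pol_sum)
qed

lemma tri_vanish: "D \<in> tri m n \<Longrightarrow> k < m \<Longrightarrow> f \<in> Pol k \<Longrightarrow> D f = 0"
  by (erule triE) (auto intro!: sum.neutral simp: pd_eq_0)

lemma tri_bracket:
  assumes D: "D \<in> tri 1 n" and E: "E \<in> tri m n" and m: "1 \<le> m"
  shows "(\<lambda>f. D (E f) - E (D f)) \<in> tri m n"
proof -
  obtain p where p: "\<And>i. p i \<in> Pol (i - 1)" "\<And>i. i \<notin> {1..n} \<Longrightarrow> p i = 0"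
    "D = (\<lambda>f. \<Sum>i=1..n. p i * pd i f)" using D by (erule triE)
  have "E \<in> tri 1 n" using E m tri_mono[of 1 m n n] by auto
  obtain q where q: "\<And>i. q i \<in> Pol (i - 1)" "\<And>i. i \<notin> {m..n} \<Longrightarrow> q i = 0"
    "E = (\<lambda>f. \<Sum>i=m..n. q i * pd i f)" using E by (erule triE)
  have E1: "E = (\<lambda>f. \<Sum>i=1..n. q i * pd i f)"
    unfolding q(3) using m q(2) by (auto simp: fun_eq_iff intro!: sum.mono_neutral_left)
  define r where "r i = D (q i) - E (p i)" for i
  have dD: "D \<in> derivations" "E \<in> derivations"
    using D E tri_subset_derivations by blast+
  have sumD: "D (sum h A) = (\<Sum>i\<in>A. D (h i))" "E (sum h A) = (\<Sum>i\<in>A. E (h i))" for h and A :: "nat set"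
    by (induction A rule: infinite_finite_induct) (auto simp: derivationsD dD)
  have r: "r i \<in> Pol (i - 1)" for i
    unfolding r_def by (intro Pol_diff tri_Pol[OF D] tri_Pol[OF E] p q)
  have r0: "r i = 0" if "1 \<le> i" "i \<notin> {m..n}" for i
  proof (cases "i < m")
    case True
    then have "E (p i) = 0" using that by (intro tri_vanish[OF E _ p(1)]) auto
    then show ?thesis using that q(2)[of i] by (simp add: r_def derivationsD dD)
  next
    case False
    then show ?thesis using that p(2)[of i] q(2)[of i] by (simp add: r_def derivationsD dD)
  qed
  have "D (E f) - E (D f) = (\<Sum>i=1..n. r i * pd i f)" for f
  proof -
    have "D (E f) = (\<Sum>i=1..n. D (q i) * pd i f) + (\<Sum>i=1..n. q i * D (pd i f))"
      by (subst E1) (simp add: sumD derivationsD dD sum.distrib)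
    moreover have "E (D f) = (\<Sum>i=1..n. E (p i) * pd i f) + (\<Sum>i=1..n. p i * E (pd i f))"
      by (subst p(3)) (simp add: sumD derivationsD dD sum.distrib)
    moreover have "(\<Sum>i=1..n. q i * D (pd i f)) = (\<Sum>i=1..n. p i * E (pd i f))"
    proof -
      have "(\<Sum>i=1..n. q i * D (pd i f)) = (\<Sum>i=1..n. \<Sum>j=1..n. q i * (p j * pd j (pd i f)))"
        by (simp add: p(3) sum_distrib_left)
      also have "\<dots> = (\<Sum>j=1..n. \<Sum>i=1..n. q i * (p j * pd j (pd i f)))"
        by (rule sum.swap)
      also have "\<dots> = (\<Sum>i=1..n. p i * E (pd i f))"
        by (simp add: E1 sum_distrib_left pd_commute mult.left_commute)
      finally show ?thesis .
    qed
    ultimately show ?thesis by (simp add: r_def sum_subtractf algebra_simps)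
  qed
  moreover have "(\<Sum>i=1..n. r i * pd i f) = (\<Sum>i=m..n. r i * pd i f)" for f
    using m r0 by (intro sum.mono_neutral_right) auto
  ultimately show ?thesis by (intro triI[of m n r] r) auto
qed

lemma lie_subalgebra:
  assumes "lie_algebra L" "S \<subseteq> carrier L" "lzero L \<in> S"
    "\<And>x y. x \<in> S \<Longrightarrow> y \<in> S \<Longrightarrow> ladd L x y \<in> S"
    "\<And>c x. x \<in> S \<Longrightarrow> lscale L c x \<in> S"
    "\<And>x y. x \<in> S \<Longrightarrow> y \<in> S \<Longrightarrow> lbracket L x y \<in> S"
  shows "lie_algebra (L \<lparr> carrier := S \<rparr>)"
proof -
  interpret lie_algebra L by fact
  note [simp] = subsetD[OF assms(2)]
  show ?thesis
    by unfold_locales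
      (use assms(3-) in \<open>simp_all add: add_assoc zero_add add_inverse scale_one scale_scale
         scale_add_left scale_add_right bracket_add_left bracket_add_right bracket_scale_left
         bracket_scale_right bracket_self jacobi\<close>, rule add_commute, simp_all)
qed

lemma lie_algebra_u_fin: "lie_algebra (u_fin n)"
  unfolding u_fin_def
  by (rule lie_subalgebra[OF lie_algebra_Der])
     (use tri_subset_derivations in \<open>auto simp: Der_def tri_0 tri_add tri_scale tri_bracket\<close>)

lemma carrier_u_fin: "carrier (u_fin n) = tri 1 n"
  by (simp add: u_fin_def)

lemma carrier_u_inf: "carrier u_inf = (\<Union>n. tri 1 n)"
proof -
  have "\<exists>n'\<ge>2. D \<in> tri 1 n'" if "D \<in> tri 1 n" for D :: "'a pol \<Rightarrow> 'a pol" and n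
    using that tri_mono[of 1 1 n "max 2 n"] by (intro exI[of _ "max 2 n"]) auto
  then show ?thesis by (auto simp: u_inf_def carrier_u_fin)
qed

lemma tri_common:
  assumes "D \<in> (\<Union>k. tri 1 k)" "E \<in> (\<Union>k. tri m k)"
  obtains k where "D \<in> tri 1 k" "E \<in> tri m k"
proof -
  obtain i j where "D \<in> tri 1 i" "E \<in> tri m j" using assms by auto
  then show ?thesis
    using that[of "max i j"] tri_mono[of 1 1 i "max i j"] tri_mono[of m m j "max i j"] by auto
qed

lemma lie_algebra_u_inf: "lie_algebra (u_inf :: ('a::field, _) lie_alg)"
proof -
  have "lie_algebra ((Der :: ('a, _) lie_alg) \<lparr> carrier := (\<Union>n. tri 1 n) \<rparr>)"
  proof (rule lie_subalgebra[OF lie_algebra_Der])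
    fix D E :: "'a pol \<Rightarrow> 'a pol" assume "D \<in> (\<Union>n. tri 1 n)" "E \<in> (\<Union>n. tri 1 n)"
    then obtain k where "D \<in> tri 1 k" "E \<in> tri 1 k" by (rule tri_common)
    then show "ladd Der D E \<in> (\<Union>n. tri 1 n)" "lbracket Der D E \<in> (\<Union>n. tri 1 n)"
      by (auto simp: Der_def intro: tri_add tri_bracket[where m = 1, simplified])
  qed (use tri_subset_derivations in \<open>auto simp: Der_def intro: tri_0 tri_scale\<close>)
  moreover have "(\<Union>n\<in>{2..}. carrier (u_fin n :: ('a, _) lie_alg)) = (\<Union>n. tri 1 n)"
    using carrier_u_inf[where 'a = 'a] by (simp add: u_inf_def)
  ultimately show ?thesis by (simp only: u_inf_def)
qed

lemma lie_ideal_u_inf_ge: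
  assumes "1 \<le> n" shows "lie_ideal u_inf (u_inf_ge n)"
proof -
  have sub: "u_inf_ge n \<subseteq> carrier u_inf"
    unfolding u_inf_ge_def carrier_u_inf using tri_mono[of 1 n] assms by blast
  have "ladd u_inf D E \<in> u_inf_ge n" if DE: "D \<in> u_inf_ge n" "E \<in> u_inf_ge n"
    for D E :: "'a pol \<Rightarrow> 'a pol"
  proof -
    obtain i j where "D \<in> tri n i" "E \<in> tri n j" using DE by (auto simp: u_inf_ge_def)
    then have "D \<in> tri n (max i j)" "E \<in> tri n (max i j)"
      using tri_mono[of n n i "max i j"] tri_mono[of n n j "max i j"] by auto
    then show ?thesis by (auto simp: u_inf_def Der_def u_inf_ge_def intro: tri_add)
  qed
  moreover have "lbracket u_inf D E \<in> u_inf_ge n" if DE: "D \<in> carrier u_inf" "E \<in> u_inf_ge n"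
    for D E :: "'a pol \<Rightarrow> 'a pol"
  proof -
    obtain k where "D \<in> tri 1 k" "E \<in> tri n k"
      using DE tri_common[of D E n] by (auto simp: u_inf_ge_def carrier_u_inf)
    then show ?thesis using tri_bracket[of D k E n] assms
      by (auto simp: u_inf_def Der_def u_inf_ge_def)
  qed
  ultimately show ?thesis
    using sub by (auto simp: lie_ideal_def) (auto simp: u_inf_def Der_def u_inf_ge_def tri_0, metis tri_scale)
qed

text \<open>\<open>u\<^sub>n\<close> acts faithfully on \<open>P\<^sub>n\<close>, so it is a Lie algebra of derivations of \<open>P\<^sub>n\<close>.\<close>

lemma u_fin_Pol: "D \<in> carrier (u_fin n) \<Longrightarrow> f \<in> Pol n \<Longrightarrow> D f \<in> Pol n"
  by (simp add: carrier_u_fin tri_Pol)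

lemma tri_eq_0_imp:
  assumes "\<And>f. f \<in> Pol n \<Longrightarrow> (\<Sum>i=1..n. p i * pd i f) = 0" "i \<in> {1..n}"
  shows "p i = 0"
proof -
  have "(\<Sum>j=1..n. p j * pd j (var i)) = (\<Sum>j=1..n. if j = i then p i else 0)"
    using assms(2) by (intro sum.cong) (auto simp: pd_var)
  then show ?thesis using assms(1)[OF Pol_var[of i n]] assms(2) by simp
qed

lemma u_fin_faithful:
  assumes "D \<in> carrier (u_fin n)" "E \<in> carrier (u_fin n)" "\<And>f. f \<in> Pol n \<Longrightarrow> D f = E f"
  shows "D = E"
proof -
  obtain p q where pq: "D = (\<lambda>f. \<Sum>i=1..n. p i * pd i f)" "E = (\<lambda>f. \<Sum>i=1..n. q i * pd i f)"
    using assms(1,2) by (auto simp: carrier_u_fin elim!: triE)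
  have "p i - q i = 0" if "i \<in> {1..n}" for i
    by (rule tri_eq_0_imp[of n "\<lambda>i. p i - q i", OF _ that])
       (use assms(3) pq in \<open>simp add: left_diff_distrib sum_subtractf\<close>)
  then show ?thesis by (auto simp: pq intro!: sum.cong)
qed


subsection \<open>Quotients\<close>

lemma coset_mem: "y \<in> lie_coset L I x \<longleftrightarrow> (\<exists>i\<in>I. y = ladd L x i)"
  by (auto simp: lie_coset_def)

lemma UN_const: "a \<in> A \<Longrightarrow> (\<And>x. x \<in> A \<Longrightarrow> f x = C) \<Longrightarrow> (\<Union>x\<in>A. f x) = C"
  by auto

lemma UN2_const:
  "a \<in> A \<Longrightarrow> b \<in> B \<Longrightarrow> (\<And>x y. x \<in> A \<Longrightarrow> y \<in> B \<Longrightarrow> f x y = C) \<Longrightarrow>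
    (\<Union>x\<in>A. \<Union>y\<in>B. f x y) = C"
  by (auto intro!: UN_const)

context lie_algebra
begin

lemma add_left_commute:
  "x \<in> carrier L \<Longrightarrow> y \<in> carrier L \<Longrightarrow> z \<in> carrier L \<Longrightarrow>
    ladd L x (ladd L y z) = ladd L y (ladd L x z)"
  by (metis add_assoc add_commute)

lemma add_zero: "x \<in> carrier L \<Longrightarrow> ladd L x (lzero L) = x"
  using add_commute zero_add zero_closed by simp

lemma add_neg_cancel:
  assumes "x \<in> carrier L" "y \<in> carrier L"
  shows "ladd L y (ladd L x (lscale L (- 1) y)) = x"
proof -
  have "ladd L y (lscale L (- 1) y) = lzero L"
    using assms add_inverse[of y] add_commute[of y "lscale L (- 1) y"] scale_closed by metis
  then show ?thesis
    using assms add_left_commute[of y x "lscale L (- 1) y"] by (simp only: scale_closed add_zero)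
qed

lemma neg_unique:
  assumes "x \<in> carrier L" "y \<in> carrier L" "ladd L x y = lzero L"
  shows "x = lscale L (- 1) y"
proof -
  have n: "lscale L (- 1) y \<in> carrier L" using assms(2) by (rule scale_closed)
  have "x = ladd L y (ladd L x (lscale L (- 1) y))"
    using add_neg_cancel[OF assms(1,2)] by (rule sym)
  also have "\<dots> = ladd L x (ladd L y (lscale L (- 1) y))"
    by (rule add_left_commute[OF assms(2,1) n])
  also have "\<dots> = ladd L (ladd L x y) (lscale L (- 1) y)"
    by (rule add_assoc[OF assms(1,2) n, symmetric])
  also have "\<dots> = lscale L (- 1) y" using n by (simp only: assms(3) zero_add)
  finally show ?thesis .
qed

lemma bracket_anti:
  assumes "x \<in> carrier L" "y \<in> carrier L"
  shows "lbracket L x y = lscale L (- 1) (lbracket L y x)"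
proof (rule neg_unique)
  let ?z = "ladd L x y"
  have z: "?z \<in> carrier L" using assms by (rule add_closed)
  have "lzero L = lbracket L ?z ?z" using z by (simp only: bracket_self)
  also have "\<dots> = ladd L (lbracket L x ?z) (lbracket L y ?z)"
    using assms z by (intro bracket_add_left)
  also have "\<dots> = ladd L (lbracket L x y) (lbracket L y x)"
    using assms by (simp add: bracket_add_right bracket_self bracket_closed zero_add add_zero)
  finally show "ladd L (lbracket L x y) (lbracket L y x) = lzero L" ..
qed (use assms bracket_closed in auto)

context
  fixes I assumes I: "lie_ideal L I"
begin

lemma ideal_closed:
  "x \<in> I \<Longrightarrow> x \<in> carrier L" "lzero L \<in> I" "x \<in> I \<Longrightarrow> y \<in> I \<Longrightarrow> ladd L x y \<in> I"
  "x \<in> I \<Longrightarrow> lscale L c x \<in> I" "x \<in> carrier L \<Longrightarrow> y \<in> I \<Longrightarrow> lbracket L x y \<in> I"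
  using I by (auto simp: lie_ideal_def)

lemma ideal_bracket_right: assumes "x \<in> I" "y \<in> carrier L" shows "lbracket L x y \<in> I"
  using assms ideal_closed(1,4,5) bracket_anti[of x y] by simp

lemma coset_self: "x \<in> carrier L \<Longrightarrow> x \<in> lie_coset L I x"
proof -
  assume "x \<in> carrier L"
  then have "x = ladd L x (lzero L)" by (simp add: add_zero)
  then show ?thesis unfolding lie_coset_def using ideal_closed(2) by blast
qed

lemma coset_add_ideal:
  assumes "x \<in> carrier L" "i \<in> I" shows "lie_coset L I (ladd L x i) = lie_coset L I x"
proof (intro equalityI subsetI)
  fix y assume "y \<in> lie_coset L I (ladd L x i)"
  then obtain j where j: "j \<in> I" "y = ladd L (ladd L x i) j" unfolding coset_mem ..
  then have "y = ladd L x (ladd L i j)" using assms add_assoc ideal_closed(1) by simp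
  then show "y \<in> lie_coset L I x" unfolding coset_mem using ideal_closed(3) assms j by blast
next
  fix y assume "y \<in> lie_coset L I x"
  then obtain j where j: "j \<in> I" "y = ladd L x j" unfolding coset_mem ..
  let ?j = "ladd L j (lscale L (- 1) i)"
  have j': "?j \<in> I" by (intro ideal_closed(3,4) assms j)
  have "ladd L i ?j = j" by (intro add_neg_cancel ideal_closed(1) assms j)
  then have "y = ladd L (ladd L x i) ?j"
    using j add_assoc[OF assms(1) ideal_closed(1)[OF assms(2)] ideal_closed(1)[OF j']] by simp
  then show "y \<in> lie_coset L I (ladd L x i)" unfolding coset_mem using j' by blast
qed

lemma coset_eq_iff:
  assumes "x \<in> carrier L" "y \<in> carrier L"
  shows "lie_coset L I x = lie_coset L I y \<longleftrightarrow> ladd L x (lscale L (- 1) y) \<in> I"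
proof
  have n: "lscale L (- 1) y \<in> carrier L" using assms(2) by (rule scale_closed)
  assume "lie_coset L I x = lie_coset L I y"
  then have "x \<in> lie_coset L I y" using coset_self[OF assms(1)] by simp
  then obtain i where i: "i \<in> I" "x = ladd L y i" unfolding coset_mem ..
  have "ladd L x (lscale L (- 1) y) = ladd L y (ladd L i (lscale L (- 1) y))"
    unfolding i(2) by (intro add_assoc assms n ideal_closed(1) i(1))
  also have "\<dots> = i" by (intro add_neg_cancel ideal_closed(1) assms i)
  finally show "ladd L x (lscale L (- 1) y) \<in> I" using i(1) by simp
next
  assume "ladd L x (lscale L (- 1) y) \<in> I"
  from coset_add_ideal[OF assms(2) this] show "lie_coset L I x = lie_coset L I y"
    by (simp only: add_neg_cancel[OF assms])
qed

lemma add_shuffle: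
  assumes "x \<in> carrier L" "i \<in> carrier L" "y \<in> carrier L" "j \<in> carrier L"
  shows "ladd L (ladd L x i) (ladd L y j) = ladd L (ladd L x y) (ladd L i j)"
proof -
  have "ladd L (ladd L x i) (ladd L y j) = ladd L x (ladd L i (ladd L y j))"
    using assms by (simp only: add_assoc add_closed)
  also have "ladd L i (ladd L y j) = ladd L y (ladd L i j)"
    using assms by (intro add_left_commute)
  also have "ladd L x \<dots> = ladd L (ladd L x y) (ladd L i j)"
    using assms by (simp only: add_assoc add_closed)
  finally show ?thesis .
qed

lemma quot_add:
  assumes "x \<in> carrier L" "y \<in> carrier L"
  shows "ladd (lie_quot L I) (lie_coset L I x) (lie_coset L I y) = lie_coset L I (ladd L x y)"
proof -
  have "lie_coset L I (ladd L (ladd L x i) (ladd L y j)) = lie_coset L I (ladd L x y)"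
    if "i \<in> I" "j \<in> I" for i j
  proof -
    have "ladd L (ladd L x i) (ladd L y j) = ladd L (ladd L x y) (ladd L i j)"
      by (intro add_shuffle assms that[THEN ideal_closed(1)])
    then show ?thesis
      using coset_add_ideal[OF add_closed[OF assms] ideal_closed(3)[OF that]] by simp
  qed
  then have "lie_coset L I (ladd L x' y') = lie_coset L I (ladd L x y)"
    if "x' \<in> lie_coset L I x" "y' \<in> lie_coset L I y" for x' y'
    using that unfolding coset_mem by blast
  from UN2_const[OF coset_self[OF assms(1)] coset_self[OF assms(2)] this] show ?thesis
    by (simp add: lie_quot_def)
qed

lemma quot_scale:
  assumes "x \<in> carrier L"
  shows "lscale (lie_quot L I) c (lie_coset L I x) = lie_coset L I (lscale L c x)"
proof -
  have "lie_coset L I (lscale L c (ladd L x i)) = lie_coset L I (lscale L c x)" if "i \<in> I" for i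
    using coset_add_ideal[OF scale_closed[OF assms, of c] ideal_closed(4)[OF that, of c]]
      scale_add_right[OF assms ideal_closed(1)[OF that]] by simp
  then have "lie_coset L I (lscale L c x') = lie_coset L I (lscale L c x)"
    if "x' \<in> lie_coset L I x" for x'
    using that unfolding coset_mem by blast
  from UN_const[OF coset_self[OF assms] this] show ?thesis
    by (simp add: lie_quot_def)
qed

lemma quot_bracket:
  assumes "x \<in> carrier L" "y \<in> carrier L"
  shows "lbracket (lie_quot L I) (lie_coset L I x) (lie_coset L I y) = lie_coset L I (lbracket L x y)"
proof -
  have "lie_coset L I (lbracket L (ladd L x i) (ladd L y j)) = lie_coset L I (lbracket L x y)"
    if "i \<in> I" "j \<in> I" for i j
  proof -
    note i = that(1) ideal_closed(1)[OF that(1)] and j = that(2) ideal_closed(1)[OF that(2)]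
    have "lbracket L (ladd L x i) (ladd L y j) =
       ladd L (lbracket L x y) (ladd L (lbracket L x j) (lbracket L i (ladd L y j)))"
      using assms i j by (simp add: bracket_add_left bracket_add_right[of x] add_assoc add_closed bracket_closed)
    moreover have "ladd L (lbracket L x j) (lbracket L i (ladd L y j)) \<in> I"
      by (intro ideal_closed(3,5) ideal_bracket_right add_closed assms i j)
    ultimately show ?thesis
      using coset_add_ideal[OF bracket_closed[OF assms]] by simp
  qed
  then have "lie_coset L I (lbracket L x' y') = lie_coset L I (lbracket L x y)"
    if "x' \<in> lie_coset L I x" "y' \<in> lie_coset L I y" for x' y'
    using that unfolding coset_mem by blast
  from UN2_const[OF coset_self[OF assms(1)] coset_self[OF assms(2)] this] show ?thesis
    by (simp add: lie_quot_def)
qed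

lemma carrier_quot: "carrier (lie_quot L I) = lie_coset L I ` carrier L"
  by (simp add: lie_quot_def)

lemma zero_quot: "lzero (lie_quot L I) = lie_coset L I (lzero L)"
  by (auto simp: lie_quot_def coset_mem zero_add ideal_closed)

lemma lie_algebra_quot: "lie_algebra (lie_quot L I)"
proof -
  note [simp] = quot_add quot_scale quot_bracket zero_quot carrier_quot
    add_closed scale_closed bracket_closed zero_closed
  show ?thesis
    by unfold_locales
      (auto simp: add_assoc zero_add add_inverse scale_one scale_scale
         scale_add_left scale_add_right bracket_add_left bracket_add_right bracket_scale_left
         bracket_scale_right bracket_self jacobi,
       simp_all add: add_commute)
qed

end

end

lemma lie_iso_u_ident:
  "lie_iso (u_fin n :: ('k::field, _) lie_alg) (lie_quot u_inf (u_inf_ge (n + 1))) (u_ident n)"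
proof -
  interpret lie_algebra "u_inf :: ('k, _) lie_alg" by (rule lie_algebra_u_inf)
  let ?U = "u_inf :: ('k, _) lie_alg" and ?F = "u_fin n :: ('k, _) lie_alg"
  let ?J = "u_inf_ge (n + 1) :: ('k pol \<Rightarrow> 'k pol) set"
  have J: "lie_ideal ?U ?J" by (rule lie_ideal_u_inf_ge) simp
  have sub: "D \<in> carrier ?U" if "D \<in> carrier ?F" for D
    using that by (auto simp: carrier_u_inf carrier_u_fin)
  have inj: "inj_on (u_ident n) (carrier ?F)"
  proof
    fix D E
    assume DE: "D \<in> carrier ?F" "E \<in> carrier ?F" "u_ident n D = u_ident n E"
    then have "ladd ?U D (lscale ?U (- 1) E) \<in> ?J"
      using coset_eq_iff[OF J sub sub] unfolding u_ident_def by blast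
    then obtain k where k: "(\<lambda>f. D f + const (- 1) * E f) \<in> tri (n + 1) k"
      unfolding u_inf_ge_def by (auto simp: u_inf_def Der_def)
    have "D f = E f" if "f \<in> Pol n" for f
      using tri_vanish[OF k _ that] by (simp add: const_uminus const_1)
    then show "D = E" using DE u_fin_faithful by blast
  qed
  have surj: "lie_coset ?U ?J D \<in> u_ident n ` carrier ?F" if D: "D \<in> carrier ?U" for D
  proof -
    obtain k where "D \<in> tri 1 k" using D unfolding carrier_u_inf by blast
    then have "D \<in> tri 1 (n + k)" using tri_mono[of 1 1 k "n + k"] by auto
    then obtain p where p: "\<And>i. p i \<in> Pol (i - 1)" "D = (\<lambda>f. \<Sum>i=1..n+k. p i * pd i f)"
      by (elim triE) blast
    let ?E = "\<lambda>f. \<Sum>i=1..n. p i * pd i f" and ?R = "\<lambda>f. \<Sum>i=n+1..n+k. p i * pd i f"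
    have E: "?E \<in> carrier ?F" unfolding carrier_u_fin by (rule triI[of 1 n p, OF p(1) refl])
    have R: "?R \<in> ?J" unfolding u_inf_ge_def by (rule UN_I[OF UNIV_I], rule triI[OF p(1) refl])
    have "D = ladd ?U ?E ?R"
    proof
      fix f
      show "D f = ladd ?U ?E ?R f"
        using sum.ub_add_nat[of 1 n "\<lambda>i. p i * pd i f" k] by (simp add: p(2) u_inf_def Der_def)
    qed
    then have "lie_coset ?U ?J D = u_ident n ?E"
      using coset_add_ideal[OF J sub[OF E] R] unfolding u_ident_def by (simp only:)
    then show ?thesis using E by (rule image_eqI)
  qed
  have "u_ident n ` carrier ?F = lie_coset ?U ?J ` carrier ?U"
    using surj sub unfolding u_ident_def by blast
  then have bij: "bij_betw (u_ident n) (carrier ?F) (carrier (lie_quot ?U ?J))"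
    using inj unfolding bij_betw_def carrier_quot[OF J] by blast
  have ops: "ladd ?F = ladd ?U" "lscale ?F = lscale ?U" "lbracket ?F = lbracket ?U"
    by (simp_all add: u_inf_def u_fin_def)
  have ident: "u_ident n = lie_coset ?U ?J" by (rule ext) (simp only: u_ident_def)
  show ?thesis
    unfolding lie_iso_def ops
  proof (intro conjI ballI allI)
    show "bij_betw (u_ident n) (carrier ?F) (carrier (lie_quot ?U ?J))" by (rule bij)
  qed (simp_all only: ident sub quot_add[OF J] quot_scale[OF J] quot_bracket[OF J])
qed

lemma reduced_ideal_eq:
  fixes I :: "('k::field pol \<Rightarrow> 'k pol) set"
  assumes "lie_ideal u_inf I" "u_inf_ge (n + 1) \<subseteq> I"
  shows "reduced_ideal n I = I \<inter> carrier (u_fin n)"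
proof -
  interpret lie_algebra "u_inf :: ('k, _) lie_alg" by (rule lie_algebra_u_inf)
  let ?J = "u_inf_ge (n + 1) :: ('k pol \<Rightarrow> 'k pol) set"
  have J: "lie_ideal u_inf ?J" by (rule lie_ideal_u_inf_ge) simp
  have "D \<in> I" if D: "D \<in> carrier (u_fin n)"
    and E: "lie_coset u_inf ?J D = lie_coset u_inf ?J E" "E \<in> I" for D E
  proof -
    have "D \<in> carrier u_inf" using D unfolding carrier_u_inf carrier_u_fin by blast
    then have "D \<in> lie_coset u_inf ?J E" using coset_self[OF J] E(1) by blast
    then obtain i where "i \<in> ?J" "D = ladd u_inf E i" unfolding coset_mem by blast
    then show ?thesis using ideal_closed(3)[OF assms(1) E(2), of i] assms(2) by blast
  qed
  then show ?thesis unfolding reduced_ideal_def u_ident_def by blast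
qed

lemma lie_ideal_reduced_ideal:
  fixes I :: "('k::field pol \<Rightarrow> 'k pol) set"
  assumes "lie_ideal u_inf I" "u_inf_ge (n + 1) \<subseteq> I"
  shows "lie_ideal (u_fin n) (reduced_ideal n I)"
proof -
  let ?F = "u_fin n :: ('k, _) lie_alg"
  interpret u: lie_algebra ?F by (rule lie_algebra_u_fin)
  have ops: "ladd ?F = ladd u_inf" "lzero ?F = lzero u_inf"
    "lscale ?F = lscale u_inf" "lbracket ?F = lbracket u_inf"
    by (simp_all add: u_inf_def u_fin_def)
  have sub: "carrier ?F \<subseteq> carrier u_inf" unfolding carrier_u_inf carrier_u_fin by blast
  have I: "lzero u_inf \<in> I" "\<And>x y. x \<in> I \<Longrightarrow> y \<in> I \<Longrightarrow> ladd u_inf x y \<in> I"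
    "\<And>c x. x \<in> I \<Longrightarrow> lscale u_inf c x \<in> I"
    "\<And>x y. x \<in> carrier u_inf \<Longrightarrow> y \<in> I \<Longrightarrow> lbracket u_inf x y \<in> I"
    using assms(1) unfolding lie_ideal_def by blast+
  show ?thesis
    unfolding reduced_ideal_eq[OF assms] lie_ideal_def
    using I sub u.add_closed u.zero_closed u.scale_closed u.bracket_closed
    unfolding ops by (intro conjI ballI allI) auto
qed

end

theory Submission
  imports Defs
begin

text \<open>Both parts rest on one observation: a nonzero ideal \<open>I\<close> of \<open>u\<^sub>\<infinity>\<close> contains some \<open>u\<^bsub>\<infinity>,m+1\<^esub>\<close>
  (\<open>nonzero_ideal_contains_tail\<close>). Bracketing \<open>0 \<noteq> D = \<Sum>\<^sub>i\<^sub>\<le>\<^sub>n p\<^sub>i\<partial>\<^sub>i \<in> I\<close> with \<open>x\<^sub>s\<partial>\<^sub>m\<close> for \<open>m = n + 1\<close>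
  isolates a coefficient, \<open>[D, x\<^sub>s\<partial>\<^sub>m] = p\<^sub>s\<partial>\<^sub>m\<close>; bracketing with the \<open>\<partial>\<^sub>j\<close> differentiates \<open>p\<^sub>s\<close> down to a
  nonzero constant, so \<open>\<partial>\<^sub>m \<in> I\<close>; and since \<open>\<partial>\<^sub>m\<close> is surjective on \<open>P\<^sub>i\<^sub>-\<^sub>1\<close> for \<open>i > m\<close>, the brackets
  \<open>[\<partial>\<^sub>m, g\<partial>\<^sub>i] = \<partial>\<^sub>m(g)\<partial>\<^sub>i\<close> exhaust \<open>P\<^sub>i\<^sub>-\<^sub>1\<partial>\<^sub>i\<close>.

  Hence a quotient of \<open>u\<^sub>\<infinity>\<close> by a nonzero ideal is solvable, because each commutation moves the
  first nonzero coefficient at least one place to the right (\<open>iterated_comms_tail\<close>). But \<open>u\<^sub>\<infinity>\<close>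
  itself is not solvable: \<open>x\<^sub>j\<^sup>a\<partial>\<^sub>i = [\<partial>\<^sub>j, x\<^sub>j\<^sup>a\<^sup>+\<^sup>1/(a+1) \<partial>\<^sub>i]\<close> shows that \<open>\<partial>\<^sub>k\<^sub>+\<^sub>2\<close> is a \<open>k\<close>-fold iterated
  commutator (\<open>iterated_comms_nonzero\<close>). This gives the first part.

  For the second part, \<open>u\<^bsub>\<infinity>,n+1\<^esub> \<subseteq> I\<close> implies \<open>u\<^sub>\<infinity> = u\<^sub>n + I\<close>, so that
  \<open>u\<^sub>\<infinity>/I \<simeq> u\<^sub>n/(I \<inter> u\<^sub>n)\<close> (\<open>quot_reduced_ideal\<close>), and likewise for \<open>J\<close>.\<close>

section \<open>Isomorphisms of Lie algebras\<close>

lemma lie_isomorphic_sym: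
  assumes "lie_algebra L" "L \<simeq>\<^sub>L M" shows "M \<simeq>\<^sub>L L"
proof -
  interpret lie_algebra L by fact
  obtain f where f: "lie_iso L M f" using assms(2) unfolding lie_isomorphic_def ..
  define g where "g = the_inv_into (carrier L) f"
  have bij: "bij_betw f (carrier L) (carrier M)" using f by (simp add: lie_iso_def)
  have gf: "g (f x) = x" if "x \<in> carrier L" for x
    using bij that unfolding g_def bij_betw_def by (simp add: the_inv_into_f_f)
  have M: "carrier M = f ` carrier L" using bij by (simp add: bij_betw_def)
  have "lie_iso M L g"
    unfolding lie_iso_def
  proof (intro conjI)
    show "bij_betw g (carrier M) (carrier L)"
      unfolding g_def by (rule bij_betw_the_inv_into[OF bij])
    show "\<forall>u\<in>carrier M. \<forall>v\<in>carrier M. g (ladd M u v) = ladd L (g u) (g v)"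
      unfolding M using f by (simp add: lie_iso_def gf add_closed) (metis gf add_closed)
    show "\<forall>c. \<forall>u\<in>carrier M. g (lscale M c u) = lscale L c (g u)"
      unfolding M using f by (simp add: lie_iso_def gf scale_closed) (metis gf scale_closed)
    show "\<forall>u\<in>carrier M. \<forall>v\<in>carrier M. g (lbracket M u v) = lbracket L (g u) (g v)"
      unfolding M using f by (simp add: lie_iso_def gf bracket_closed) (metis gf bracket_closed)
  qed
  then show ?thesis unfolding lie_isomorphic_def by blast
qed

lemma lie_isomorphic_trans:
  assumes "L \<simeq>\<^sub>L M" "M \<simeq>\<^sub>L N" shows "L \<simeq>\<^sub>L N"
proof -
  obtain f g where f: "lie_iso L M f" and g: "lie_iso M N g"
    using assms unfolding lie_isomorphic_def by blast
  have "f x \<in> carrier M" if "x \<in> carrier L" for x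
    using f that unfolding lie_iso_def bij_betw_def by blast
  then have "lie_iso L N (g \<circ> f)"
    using f g unfolding lie_iso_def by (auto intro: bij_betw_trans)
  then show ?thesis unfolding lie_isomorphic_def by blast
qed

text \<open>The first isomorphism theorem; the last hypothesis says that the kernel of \<open>f\<close> is \<open>I\<close>.\<close>

lemma lie_quot_isomorphic_image:
  assumes L: "lie_algebra L" and I: "lie_ideal L I"
    and onto: "f ` carrier L = carrier M"
    and add: "\<And>x y. x \<in> carrier L \<Longrightarrow> y \<in> carrier L \<Longrightarrow> f (ladd L x y) = ladd M (f x) (f y)"
    and scale: "\<And>c x. x \<in> carrier L \<Longrightarrow> f (lscale L c x) = lscale M c (f x)"
    and bracket: "\<And>x y. x \<in> carrier L \<Longrightarrow> y \<in> carrier L \<Longrightarrow>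
      f (lbracket L x y) = lbracket M (f x) (f y)"
    and ker: "\<And>x y. x \<in> carrier L \<Longrightarrow> y \<in> carrier L \<Longrightarrow>
      f x = f y \<longleftrightarrow> lie_coset L I x = lie_coset L I y"
  shows "lie_quot L I \<simeq>\<^sub>L M"
proof -
  interpret lie_algebra L by fact
  define g where "g A = the_elem (f ` A)" for A
  have g: "g (lie_coset L I x) = f x" if x: "x \<in> carrier L" for x
  proof -
    have "f y = f x" if y: "y \<in> lie_coset L I x" for y
    proof -
      obtain i where i: "i \<in> I" "y = ladd L x i" using y unfolding coset_mem by blast
      have "y \<in> carrier L" unfolding i(2) by (intro add_closed x ideal_closed(1)[OF I] i(1))
      then show ?thesis using ker[OF _ x] coset_add_ideal[OF I x i(1)] i(2) by simp
    qed
    then have "f ` lie_coset L I x = {f x}" using coset_self[OF I x] by blast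
    then show ?thesis by (simp add: g_def)
  qed
  have "bij_betw g (carrier (lie_quot L I)) (carrier M)"
    unfolding bij_betw_def
  proof
    show "inj_on g (carrier (lie_quot L I))"
      by (auto simp: inj_on_def carrier_quot[OF I] g ker)
    show "g ` carrier (lie_quot L I) = carrier M"
      by (simp add: carrier_quot[OF I] image_image g flip: onto)
  qed
  then have "lie_iso (lie_quot L I) M g"
    unfolding lie_iso_def
    by (auto simp: carrier_quot[OF I] quot_add[OF I] quot_scale[OF I] quot_bracket[OF I] g
        add scale bracket add_closed scale_closed bracket_closed)
  then show ?thesis unfolding lie_isomorphic_def by blast
qed

lemma lie_quot_zero_ideal:
  assumes "lie_algebra L" shows "lie_quot L {lzero L} \<simeq>\<^sub>L L"
proof -
  interpret lie_algebra L by fact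
  have scale0: "lscale L 0 x = lzero L" if "x \<in> carrier L" for x
  proof -
    have "lzero L = ladd L (lscale L (- 1) (lscale L 0 x)) (lscale L 0 x)"
      by (simp add: add_inverse scale_closed that)
    also have "\<dots> = lscale L (- 1 * 0 + 0) x" using that by (simp only: scale_scale scale_add_left)
    finally show ?thesis by simp
  qed
  have scale: "lscale L c (lzero L) = lzero L" for c
    using scale_scale[OF zero_closed, of c 0] scale0[OF zero_closed] by simp
  have "lbracket L x (lzero L) = lzero L" if "x \<in> carrier L" for x
    using bracket_scale_right[OF that zero_closed, of 0]
      scale0[OF zero_closed] scale0[OF bracket_closed[OF that zero_closed]] by simp
  then have I: "lie_ideal L {lzero L}"
    by (simp add: lie_ideal_def zero_closed zero_add scale)
  show ?thesis
    by (rule lie_quot_isomorphic_image[OF assms I, of "\<lambda>x. x"])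
      (auto simp: lie_coset_def add_zero)
qed

text \<open>The second isomorphism theorem: if \<open>L = S + I\<close> then \<open>S/(S \<inter> I) \<simeq> L/I\<close>.\<close>

lemma lie_quot_subalgebra:
  assumes L: "lie_algebra L" and I: "lie_ideal L I"
    and S: "lie_algebra (L\<lparr>carrier := S\<rparr>)" "S \<subseteq> carrier L"
    and I': "lie_ideal (L\<lparr>carrier := S\<rparr>) (I \<inter> S)"
    and sum: "\<And>x. x \<in> carrier L \<Longrightarrow> \<exists>s\<in>S. \<exists>i\<in>I. x = ladd L s i"
  shows "lie_quot (L\<lparr>carrier := S\<rparr>) (I \<inter> S) \<simeq>\<^sub>L lie_quot L I"
proof (rule lie_quot_isomorphic_image[OF S(1) I', of "lie_coset L I"])
  interpret lie_algebra L by fact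
  interpret S: lie_algebra "L\<lparr>carrier := S\<rparr>" by fact
  have "lie_coset L I x \<in> lie_coset L I ` S" if "x \<in> carrier L" for x
  proof -
    obtain s i where si: "s \<in> S" "i \<in> I" "x = ladd L s i" using sum[OF \<open>x \<in> carrier L\<close>] by blast
    then have "lie_coset L I x = lie_coset L I s" using coset_add_ideal[OF I] S(2) by blast
    then show ?thesis using si(1) by (rule image_eqI)
  qed
  then show "lie_coset L I ` carrier (L\<lparr>carrier := S\<rparr>) = carrier (lie_quot L I)"
    using S(2) by (auto simp: carrier_quot[OF I])
  fix x y assume xy: "x \<in> carrier (L\<lparr>carrier := S\<rparr>)" "y \<in> carrier (L\<lparr>carrier := S\<rparr>)"
  have "ladd L x (lscale L (- 1) y) \<in> S"
    using S.add_closed[OF xy(1) S.scale_closed[OF xy(2)]] by simp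
  then show "lie_coset L I x = lie_coset L I y \<longleftrightarrow>
      lie_coset (L\<lparr>carrier := S\<rparr>) (I \<inter> S) x = lie_coset (L\<lparr>carrier := S\<rparr>) (I \<inter> S) y"
    using coset_eq_iff[OF I, of x y] S.coset_eq_iff[OF I' xy] xy S(2) by auto
qed (simp_all add: subsetD[OF S(2)] lie_algebra.quot_add[OF L I] lie_algebra.quot_scale[OF L I]
    lie_algebra.quot_bracket[OF L I])

section \<open>Iterated commutators\<close>

text \<open>These are the bare brackets, without taking spans. By bilinearity the \<open>k\<close>-th set spans the
  \<open>k\<close>-th term of the derived series, so both become zero at the same stage.\<close>

primrec iterated_comms :: "('k, 'v) lie_alg \<Rightarrow> nat \<Rightarrow> 'v set" where
  "iterated_comms L 0 = carrier L"
| "iterated_comms L (Suc k) =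
     {lbracket L x y | x y. x \<in> iterated_comms L k \<and> y \<in> iterated_comms L k}"

lemma iterated_comms_image:
  assumes L: "lie_algebra L" and onto: "f ` carrier L = carrier M"
    and bracket: "\<And>x y. x \<in> carrier L \<Longrightarrow> y \<in> carrier L \<Longrightarrow>
      f (lbracket L x y) = lbracket M (f x) (f y)"
  shows "iterated_comms M k = f ` iterated_comms L k"
proof -
  interpret lie_algebra L by fact
  have sub: "iterated_comms L k \<subseteq> carrier L" for k
    by (induction k) (auto intro!: bracket_closed)
  show ?thesis
  proof (induction k)
    case (Suc k)
    have br: "lbracket M (f x) (f y) = f (lbracket L x y)"
      if "x \<in> iterated_comms L k" "y \<in> iterated_comms L k" for x y
      using bracket sub that by (simp add: subset_iff)
    have "iterated_comms M (Suc k) =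
        {lbracket M (f x) (f y) | x y. x \<in> iterated_comms L k \<and> y \<in> iterated_comms L k}"
      unfolding iterated_comms.simps Suc by blast
    also have "\<dots> =
        {f (lbracket L x y) | x y. x \<in> iterated_comms L k \<and> y \<in> iterated_comms L k}"
      using br by (intro Collect_cong) metis
    also have "\<dots> = f ` iterated_comms L (Suc k)"
      unfolding iterated_comms.simps by blast
    finally show ?case .
  qed (simp add: onto)
qed

section \<open>Single terms of triangular derivations\<close>

definition term_der :: "'k::field pol \<Rightarrow> nat \<Rightarrow> 'k pol \<Rightarrow> 'k pol" where
  "term_der p i = (\<lambda>f. p * pd i f)"

lemma u_inf_ops:
  "ladd u_inf D E = (\<lambda>f. D f + E f)" "lzero u_inf = (\<lambda>f. 0)"
  "lscale u_inf c D = (\<lambda>f. const c * D f)" "lbracket u_inf D E = (\<lambda>f. D (E f) - E (D f))"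
  by (simp_all add: u_inf_def Der_def)

lemma term_der_tri: "p \<in> Pol (i - 1) \<Longrightarrow> term_der p i \<in> tri i i"
  by (rule triI[of i i "\<lambda>_. p"]) (auto simp: term_der_def)

lemma term_der_u_inf: "1 \<le> i \<Longrightarrow> p \<in> Pol (i - 1) \<Longrightarrow> term_der p i \<in> carrier u_inf"
  using term_der_tri[of p i] tri_mono[of 1 i i i] unfolding carrier_u_inf by blast

text \<open>The other half of the bracket, \<open>q\<partial>\<^sub>i \<circ> D\<close>, contributes only second-order terms, since \<open>x\<^sub>i\<close>
  does not occur in the coefficients of \<open>D\<close>; they cancel those of \<open>D \<circ> q\<partial>\<^sub>i\<close>.\<close>

lemma bracket_term_der:
  assumes D: "D \<in> tri 1 n" and "n < i"
  shows "lbracket u_inf D (term_der q i) = term_der (D q) i"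
proof
  fix f
  obtain p where p: "\<And>j. p j \<in> Pol (j - 1)" "D = (\<lambda>f. \<Sum>j=1..n. p j * pd j f)"
    using D by (elim triE) blast
  have "pd i (p j) = 0" if "j \<in> {1..n}" for j
    using that assms(2) by (intro pd_eq_0[OF p(1)]) auto
  then have "pd i (D f) = D (pd i f)"
    by (auto simp: p(2) pd_sum pd_mult pd_commute[of i] intro!: sum.cong)
  moreover have "D \<in> derivations" using D tri_subset_derivations by blast
  ultimately show "lbracket u_inf D (term_der q i) f = term_der (D q) i f"
    by (simp add: u_inf_ops term_der_def derivationsD)
qed

lemma bracket_pd_term_der:
  assumes "1 \<le> j" "j < i"
  shows "lbracket u_inf (term_der 1 j) (term_der q i) = term_der (pd j q) i"
proof -
  have "term_der 1 j \<in> tri 1 j"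
    using term_der_tri[of 1 j] tri_mono[of 1 j j j] assms(1) Pol_const[of 1 "j - 1"]
    by (auto simp: const_1)
  from bracket_term_der[OF this assms(2), of q] show ?thesis by (simp add: term_der_def)
qed

section \<open>Differentiation of polynomials\<close>

lemma Pol_antiderivative:
  fixes f :: "'k::field_char_0 pol"
  assumes f: "f \<in> Pol n" and m: "1 \<le> m" "m \<le> n"
  obtains g where "g \<in> Pol n" "pd m g = f"
proof -
  define h where "h k = Poly_Mapping.single (k + xexp m)
    (Poly_Mapping.lookup f k / of_nat (Poly_Mapping.lookup k (m - 1) + 1))" for k
  have "h k \<in> Pol n" if "k \<in> Poly_Mapping.keys f" for k
  proof -
    have "Poly_Mapping.keys k \<subseteq> {..<n}" using f that by (auto simp: Pol_def)
    moreover have "Poly_Mapping.keys (xexp m) \<subseteq> {..<n}" using m by auto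
    ultimately have "Poly_Mapping.keys (k + xexp m) \<subseteq> {..<n}"
      using Poly_Mapping.keys_add[of k "xexp m"] by blast
    then show ?thesis by (auto simp: Pol_def h_def)
  qed
  then have 1: "sum h (Poly_Mapping.keys f) \<in> Pol n" by (rule Pol_sum)
  have "pd m (h k) = Poly_Mapping.single k (Poly_Mapping.lookup f k)" for k
  proof -
    have "(of_nat (Poly_Mapping.lookup k (m - 1) + 1) :: 'k) \<noteq> 0"
      by (simp only: of_nat_eq_0_iff)
    then show ?thesis
      unfolding h_def by (simp only: pd_single lookup_add lookup_single when_def) simp
  qed
  then have "pd m (sum h (Poly_Mapping.keys f)) = f"
    using poly_eq_sum_single[of f] by (simp add: pd_sum)
  with 1 show thesis by (rule that)
qed

text \<open>Each differentiation by a variable that occurs lowers the total degree, and in characteristic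
  zero it does not kill the polynomial. The total degree of an exponent vector is written as a sum
  over \<open>{..<n}\<close>, which is additive.\<close>

lemma pd_closed_contains_const:
  fixes S :: "'k::field_char_0 pol set"
  assumes closed: "\<And>j h. 1 \<le> j \<Longrightarrow> j \<le> n \<Longrightarrow> h \<in> S \<Longrightarrow> pd j h \<in> S"
    and S: "S \<subseteq> Pol n" and p: "p \<in> S" "p \<noteq> 0"
  shows "\<exists>c. c \<noteq> 0 \<and> const c \<in> S"
proof -
  let ?deg = "\<lambda>m. \<Sum>i<n. Poly_Mapping.lookup m i"
  have "\<exists>c. c \<noteq> 0 \<and> const c \<in> S"
    if "p \<in> S" "p \<noteq> 0" "\<forall>m\<in>Poly_Mapping.keys p. ?deg m \<le> d" for d p
    using that
  proof (induction d arbitrary: p rule: less_induct)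
    case (less d)
    show ?case
    proof (cases "Poly_Mapping.keys p \<subseteq> {0}")
      case True
      have "p = const (Poly_Mapping.lookup p 0)"
      proof (rule poly_mapping_eqI)
        show "Poly_Mapping.lookup p m = Poly_Mapping.lookup (const (Poly_Mapping.lookup p 0)) m" for m
          using True by (auto simp: const_def lookup_single when_def in_keys_iff)
      qed
      moreover have "Poly_Mapping.lookup p 0 \<noteq> 0"
        using True less.prems(2) by (metis in_keys_iff keys_eq_empty singleton_iff subset_singletonD insertI1)
      ultimately show ?thesis using less.prems(1) by metis
    next
      case False
      then obtain m where m: "m \<in> Poly_Mapping.keys p" "m \<noteq> 0" by blast
      then obtain i where i: "Poly_Mapping.lookup m i \<noteq> 0"
        by (metis lookup_zero poly_mapping_eqI)
      have "p \<in> Pol n" using S less.prems(1) by blast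
      then have "Poly_Mapping.keys m \<subseteq> {..<n}" using m(1) unfolding Pol_def by blast
      then have "i < n" using i by (auto simp: subset_iff in_keys_iff)
      let ?q = "pd (Suc i) p"
      have "m - xexp (Suc i) + xexp (Suc i) = m"
        using i by (intro poly_mapping_eqI) (auto simp: lookup_add lookup_minus lookup_single when_def)
      moreover have "(of_nat (Poly_Mapping.lookup (m - xexp (Suc i)) i + 1) :: 'k) \<noteq> 0"
        by (simp only: of_nat_eq_0_iff)
      ultimately have "Poly_Mapping.lookup ?q (m - xexp (Suc i)) \<noteq> 0"
        using m(1) by (simp add: lookup_pd in_keys_iff del: of_nat_add of_nat_Suc)
      then have q0: "?q \<noteq> 0" by auto
      have deg: "?deg k + 1 \<le> d" if "k \<in> Poly_Mapping.keys ?q" for k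
      proof -
        have "k + xexp (Suc i) \<in> Poly_Mapping.keys p"
          using that by (auto simp: in_keys_iff lookup_pd)
        moreover have "?deg (k + xexp (Suc i)) = ?deg k + 1"
          using \<open>i < n\<close> by (simp add: lookup_add lookup_single when_def sum.distrib)
        ultimately show ?thesis using less.prems(3) by fastforce
      qed
      obtain k where "k \<in> Poly_Mapping.keys ?q" using q0 by fastforce
      then have "d - 1 < d" using deg by fastforce
      moreover have "?q \<in> S" using \<open>i < n\<close> less.prems(1) by (intro closed) auto
      moreover have "\<forall>k\<in>Poly_Mapping.keys ?q. ?deg k \<le> d - 1" using deg by fastforce
      ultimately show ?thesis using q0 by (intro less.IH)
    qed
  qed
  moreover have "\<forall>m\<in>Poly_Mapping.keys p. ?deg m \<le> Max (?deg ` Poly_Mapping.keys p)" by simp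
  ultimately show ?thesis using p by blast
qed

section \<open>Nonzero ideals\<close>

lemma u_inf_ge_mono: "m \<le> n \<Longrightarrow> u_inf_ge n \<subseteq> u_inf_ge m"
  unfolding u_inf_ge_def using tri_mono[of m n] by blast

text \<open>Each \<open>f\<partial>\<^sub>i\<close> with \<open>i > m\<close> equals \<open>[\<partial>\<^sub>m, g\<partial>\<^sub>i]\<close> for an antiderivative \<open>g\<close> of \<open>f\<close> with respect to
  \<open>x\<^sub>m\<close>; such a \<open>g\<close> exists in \<open>P\<^sub>i\<^sub>-\<^sub>1\<close> because \<open>m \<le> i - 1\<close>.\<close>

lemma ideal_contains_tail:
  fixes I :: "('k::field_char_0 pol \<Rightarrow> 'k pol) set"
  assumes I: "lie_ideal u_inf I" and m: "1 \<le> m" "term_der 1 m \<in> I"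
  shows "u_inf_ge (m + 1) \<subseteq> I"
proof
  interpret lie_algebra "u_inf :: ('k, _) lie_alg" by (rule lie_algebra_u_inf)
  fix D :: "'k pol \<Rightarrow> 'k pol" assume "D \<in> u_inf_ge (m + 1)"
  then obtain n where "D \<in> tri (m + 1) n" unfolding u_inf_ge_def ..
  then obtain p where p: "\<And>i. p i \<in> Pol (i - 1)" "D = (\<lambda>f. \<Sum>i=m+1..n. p i * pd i f)"
    by (elim triE) blast
  have terms: "term_der (p i) i \<in> I" if "i \<in> {m+1..n}" for i
  proof -
    have "m \<le> i - 1" using that by auto
    then obtain g where g: "g \<in> Pol (i - 1)" "pd m g = p i"
      by (rule Pol_antiderivative[OF p(1)[of i] m(1)])
    have "lbracket u_inf (term_der 1 m) (term_der g i) \<in> I"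
      using that by (intro ideal_bracket_right[OF I m(2)] term_der_u_inf g(1)) auto
    then show ?thesis using bracket_pd_term_der[OF m(1), of i g] that g(2) by simp
  qed
  have "(\<lambda>f. \<Sum>i\<in>A. p i * pd i f) \<in> I" if "A \<subseteq> {m+1..n}" "finite A" for A
    using that(2,1)
  proof (induction A)
    case empty
    then show ?case using ideal_closed(2)[OF I] by (simp add: u_inf_ops)
  next
    case (insert i A)
    then show ?case
      using terms[of i] ideal_closed(3)[OF I, of "term_der (p i) i" "\<lambda>f. \<Sum>i\<in>A. p i * pd i f"]
      by (simp add: u_inf_ops term_der_def)
  qed
  then show "D \<in> I" unfolding p(2) by blast
qed

lemma nonzero_ideal_contains_tail:
  fixes I :: "('k::field_char_0 pol \<Rightarrow> 'k pol) set"
  assumes I: "lie_ideal u_inf I" and nz: "I \<noteq> {lzero u_inf}"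
  obtains m where "2 \<le> m" "u_inf_ge (m + 1) \<subseteq> I"
proof -
  interpret lie_algebra "u_inf :: ('k, _) lie_alg" by (rule lie_algebra_u_inf)
  obtain D where D: "D \<in> I" "D \<noteq> lzero u_inf" using nz ideal_closed(2)[OF I] by blast
  obtain k where "D \<in> tri 1 k" using ideal_closed(1)[OF I D(1)] unfolding carrier_u_inf by blast
  then have Dk: "D \<in> tri 1 (Suc k)" using tri_mono[of 1 1 k "Suc k"] by auto
  define n where "n = Suc k"
  have Dn: "D \<in> tri 1 n" and n: "1 \<le> n" using Dk by (simp_all add: n_def)
  obtain p where p: "D = (\<lambda>f. \<Sum>i=1..n. p i * pd i f)" using Dn by (elim triE) blast
  obtain s where s: "s \<in> {1..n}" "p s \<noteq> 0"
    using D(2) p by (force simp: u_inf_ops intro!: sum.neutral)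
  have "D (var s) = (\<Sum>i=1..n. if i = s then p i else 0)"
    unfolding p using s(1) by (intro sum.cong) (auto simp: pd_var)
  then have Ds: "D (var s) = p s" using s(1) by simp
  \<comment> \<open>The polynomials \<open>h\<close> with \<open>h\<partial>\<^sub>n\<^sub>+\<^sub>1 \<in> I\<close>. Brackets with \<open>\<partial>\<^sub>j\<close> make this set closed under
    differentiation, and the bracket of \<open>D\<close> with \<open>x\<^sub>s\<partial>\<^sub>n\<^sub>+\<^sub>1\<close> puts \<open>p\<^sub>s\<close> into it.\<close>
  let ?S = "{h \<in> Pol n. term_der h (n + 1) \<in> I}"
  have "\<exists>c. c \<noteq> 0 \<and> const c \<in> ?S"
  proof (rule pd_closed_contains_const[of n])
    fix j h assume j: "1 \<le> j" "j \<le> n" and h: "h \<in> ?S"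
    have "lbracket u_inf (term_der 1 j) (term_der h (n + 1)) \<in> I"
      using h j Pol_const[of 1] by (intro ideal_closed(5)[OF I] term_der_u_inf) (auto simp: const_1)
    then show "pd j h \<in> ?S" using h j bracket_pd_term_der[OF j(1), of "n + 1" h] by (simp add: Pol_pd)
  next
    have v: "var s \<in> Pol n" using s by (intro Pol_var) auto
    have "lbracket u_inf D (term_der (var s) (n + 1)) \<in> I"
      using v by (intro ideal_bracket_right[OF I D(1)] term_der_u_inf) auto
    then show "D (var s) \<in> ?S"
      using bracket_term_der[OF Dn, of "n + 1" "var s"] tri_Pol[OF Dn v] by simp
    show "D (var s) \<noteq> 0" using s(2) by (simp add: Ds)
  qed auto
  then obtain c where c: "c \<noteq> 0" "term_der (const c) (n + 1) \<in> I" by blast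
  have "lscale u_inf (1 / c) (term_der (const c) (n + 1)) \<in> I" by (intro ideal_closed(4)[OF I] c)
  moreover have "lscale u_inf (1 / c) (term_der (const c) (n + 1)) = term_der 1 (n + 1)"
    using c(1) by (simp add: u_inf_ops term_der_def flip: mult.assoc const_mult) (simp add: const_1)
  ultimately have "term_der 1 (n + 1) \<in> I" by simp
  then have "u_inf_ge (n + 1 + 1) \<subseteq> I" by (intro ideal_contains_tail[OF I]) auto
  then show thesis using n by (intro that[of "n + 1"]) auto
qed

section \<open>Solvability\<close>

text \<open>The coefficient of \<open>\<partial>\<^sub>m\<close> in \<open>[D, E]\<close> is \<open>D(E(x\<^sub>m)) - E(D(x\<^sub>m))\<close>. It vanishes because \<open>D\<close> and \<open>E\<close>
  map \<open>x\<^sub>m\<close> into \<open>P\<^sub>m\<^sub>-\<^sub>1\<close>, which both of them kill.\<close>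

lemma bracket_u_inf_ge:
  fixes D E :: "'k::field pol \<Rightarrow> 'k pol"
  assumes DE: "D \<in> u_inf_ge m" "E \<in> u_inf_ge m" and m: "1 \<le> m"
  shows "lbracket u_inf D E \<in> u_inf_ge (m + 1)"
proof -
  obtain i j where "D \<in> tri m i" "E \<in> tri m j" using DE unfolding u_inf_ge_def by blast
  then obtain n where D: "D \<in> tri m n" and E: "E \<in> tri m n" and n: "m \<le> n"
    using tri_mono[of m m i "i + j + m"] tri_mono[of m m j "i + j + m"] by force
  have D1: "D \<in> tri 1 n" using D m tri_mono[of 1 m n n] by auto
  obtain r where r: "\<And>i. r i \<in> Pol (i - 1)" "lbracket u_inf D E = (\<lambda>f. \<Sum>i=m..n. r i * pd i f)"
    using tri_bracket[OF D1 E m] unfolding u_inf_ops by (elim triE) blast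
  have dd: "D \<in> derivations" "E \<in> derivations" using D E tri_subset_derivations by blast+
  have eval: "F (var m) \<in> Pol (m - 1)" if F: "F \<in> tri m n" for F :: "'k pol \<Rightarrow> 'k pol"
  proof -
    obtain q where q: "\<And>i. q i \<in> Pol (i - 1)" "F = (\<lambda>f. \<Sum>i=m..n. q i * pd i f)"
      using F by (elim triE) blast
    have "F (var m) = (\<Sum>i=m..n. if i = m then q i else 0)"
      unfolding q(2) using m by (intro sum.cong) (auto simp: pd_var)
    then show ?thesis using n q(1) by simp
  qed
  have "lbracket u_inf D E (var m) = (\<Sum>i=m..n. if i = m then r i else 0)"
    unfolding r(2) using m by (intro sum.cong) (auto simp: pd_var)
  then have "r m = lbracket u_inf D E (var m)" using n by simp
  also have "\<dots> = 0"
    using tri_vanish[OF D _ eval[OF E]] tri_vanish[OF E _ eval[OF D]] m by (simp add: u_inf_ops)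
  finally have "lbracket u_inf D E = (\<lambda>f. \<Sum>i=m+1..n. r i * pd i f)"
    using n by (simp add: r(2) sum.atLeast_Suc_atMost)
  then have "lbracket u_inf D E \<in> tri (m + 1) n" using r(1) by (intro triI) auto
  then show ?thesis unfolding u_inf_ge_def by blast
qed

lemma iterated_comms_tail: "iterated_comms u_inf k \<subseteq> u_inf_ge (k + 1)"
proof (induction k)
  case 0
  show ?case by (simp add: carrier_u_inf u_inf_ge_def)
next
  case (Suc k)
  then show ?case using bracket_u_inf_ge[of _ "k + 1"] by fastforce
qed

lemma Pol_power: "f \<in> Pol n \<Longrightarrow> f ^ a \<in> Pol n"
  by (induction a) (use Pol_const[of 1 n] in \<open>auto simp: Pol_mult const_1\<close>)

lemma pd_var_power:
  assumes "1 \<le> j" shows "pd j (var j ^ Suc a) = (const (of_nat (Suc a)) * var j ^ a :: 'k::field pol)"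
proof (induction a)
  case 0
  have "pd j (var j ^ Suc 0) = pd j (var j :: 'k pol)" by (simp only: power_Suc power_0 mult_1_right)
  then show ?case using assms by (simp add: pd_var const_1)
next
  case (Suc a)
  have "pd j (var j ^ Suc (Suc a)) = (var j ^ Suc a + var j * pd j (var j ^ Suc a) :: 'k pol)"
    using assms by (simp only: power_Suc[of _ "Suc a"] pd_mult) (simp only: pd_var refl if_True mult_1_left)
  also have "\<dots> = (1 + const (of_nat (Suc a))) * var j ^ Suc a"
    unfolding Suc by (simp only: distrib_left distrib_right mult_1_left power_Suc mult.left_commute)
  also have "1 + const (of_nat (Suc a)) = (const (of_nat (Suc (Suc a))) :: 'k pol)"
    by (simp only: of_nat_Suc[of "Suc a"] const_add const_1)
  finally show ?case .
qed

text \<open>The induction step writes \<open>x\<^sub>j\<^sup>a\<partial>\<^sub>i\<close> as \<open>[\<partial>\<^sub>j, x\<^sub>j\<^sup>a\<^sup>+\<^sup>1/(a+1) \<partial>\<^sub>i]\<close>. The hypothesis covers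
  \<open>\<partial>\<^sub>j = x\<^sub>j\<^sub>-\<^sub>1\<^sup>0\<partial>\<^sub>j\<close> only at the index \<open>j - 1\<close>, which is why the bound on \<open>j\<close> rises with \<open>k\<close>.\<close>

lemma term_der_iterated_comms:
  fixes c :: "'k::field_char_0"
  assumes "k < j" "j < i"
  shows "term_der (const c * var j ^ a) i \<in> iterated_comms u_inf k"
  using assms
proof (induction k arbitrary: i j a c)
  case 0
  then have "const c * var j ^ a \<in> Pol (i - 1)"
    by (intro Pol_mult Pol_const Pol_power Pol_var) auto
  then show ?case using 0 by (simp add: term_der_u_inf)
next
  case (Suc k)
  let ?g = "const (c / of_nat (Suc a)) * var j ^ Suc a"
  have "term_der (const 1 * var (j - 1) ^ 0) j \<in> iterated_comms (u_inf :: ('k, _) lie_alg) k"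
    by (rule Suc.IH) (use Suc.prems in auto)
  then have "term_der 1 j \<in> iterated_comms (u_inf :: ('k, _) lie_alg) k" by (simp add: const_1)
  moreover have "term_der ?g i \<in> iterated_comms u_inf k"
    by (rule Suc.IH) (use Suc.prems in auto)
  moreover have "lbracket u_inf (term_der 1 j) (term_der ?g i) = term_der (const c * var j ^ a) i"
  proof -
    have "(of_nat (Suc a) :: 'k) \<noteq> 0" by (simp only: of_nat_eq_0_iff)
    then have "const (c / of_nat (Suc a)) * (const (of_nat (Suc a)) * var j ^ a) = const c * var j ^ a"
      by (simp only: flip: mult.assoc const_mult) simp
    then have "pd j ?g = const c * var j ^ a"
      using Suc.prems by (simp only: pd_mult pd_const pd_var_power) simp
    then show ?thesis using Suc.prems by (simp only: bracket_pd_term_der)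
  qed
  ultimately show ?case by (simp only: iterated_comms.simps mem_Collect_eq) metis
qed

lemma iterated_comms_nonzero:
  "lzero u_inf \<in> iterated_comms (u_inf :: ('k::field_char_0, _) lie_alg) k"
  "term_der 1 (k + 2) \<in> iterated_comms (u_inf :: ('k, _) lie_alg) k"
  "term_der 1 (k + 2) \<noteq> lzero (u_inf :: ('k, _) lie_alg)"
proof -
  have c: "term_der (const c) (k + 2) \<in> iterated_comms (u_inf :: ('k, _) lie_alg) k" for c
    using term_der_iterated_comms[of k "k + 1" "k + 2" c 0] by simp
  show "lzero u_inf \<in> iterated_comms (u_inf :: ('k, _) lie_alg) k"
    using c[of 0] by (simp add: u_inf_ops term_der_def const_def)
  show "term_der 1 (k + 2) \<in> iterated_comms (u_inf :: ('k, _) lie_alg) k"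
    using c[of 1] by (simp add: const_1)
  have "term_der 1 (k + 2) (var (k + 2)) = (1 :: 'k pol)" by (simp add: term_der_def pd_var)
  then show "term_der 1 (k + 2) \<noteq> lzero (u_inf :: ('k, _) lie_alg)"
    by (auto simp: u_inf_ops)
qed

text \<open>An isomorphism would carry the \<open>m\<close>-fold commutators of \<open>u\<^sub>\<infinity>/I\<close>, all zero when
  \<open>u\<^bsub>\<infinity>,m+1\<^esub> \<subseteq> I\<close>, onto those of \<open>u\<^sub>\<infinity>\<close>, which are not all zero.\<close>

lemma quot_nonzero_ideal_not_isomorphic:
  fixes I :: "('k::field_char_0 pol \<Rightarrow> 'k pol) set"
  assumes I: "lie_ideal u_inf I" and nz: "I \<noteq> {lzero u_inf}"
  shows "\<not> lie_quot u_inf I \<simeq>\<^sub>L (u_inf :: ('k, 'k pol \<Rightarrow> 'k pol) lie_alg)"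
proof
  interpret lie_algebra "u_inf :: ('k, _) lie_alg" by (rule lie_algebra_u_inf)
  let ?U = "u_inf :: ('k, _) lie_alg"
  obtain m where m: "u_inf_ge (m + 1) \<subseteq> I" using nonzero_ideal_contains_tail[OF I nz] .
  assume "lie_quot ?U I \<simeq>\<^sub>L ?U"
  then obtain f where f: "lie_iso (lie_quot ?U I) ?U f" unfolding lie_isomorphic_def ..
  have U: "iterated_comms ?U m = f ` iterated_comms (lie_quot ?U I) m"
    using f by (intro iterated_comms_image[OF lie_algebra_quot[OF I]])
      (auto simp: lie_iso_def bij_betw_def)
  have Q: "iterated_comms (lie_quot ?U I) m = lie_coset ?U I ` iterated_comms ?U m"
    by (rule iterated_comms_image[OF lie_algebra_u_inf])
      (simp_all add: carrier_quot[OF I] quot_bracket[OF I])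
  have "lie_coset ?U I D = lie_coset ?U I (lzero ?U)" if "D \<in> iterated_comms ?U m" for D
  proof -
    have "D \<in> I" using that iterated_comms_tail m by blast
    then show ?thesis
      using coset_add_ideal[OF I zero_closed, of D] zero_add[OF ideal_closed(1)[OF I], of D] by simp
  qed
  then have "iterated_comms ?U m \<subseteq> {f (lie_coset ?U I (lzero ?U))}"
    by (subst U, subst Q) auto
  from subsetD[OF this iterated_comms_nonzero(1)] subsetD[OF this iterated_comms_nonzero(2)]
  have "term_der 1 (m + 2) = lzero ?U" by simp
  then show False using iterated_comms_nonzero(3)[of m, where 'k = 'k] by blast
qed

section \<open>Reduction to finitely many variables\<close>

lemma tri_split:
  assumes "D \<in> carrier u_inf"
  obtains E R where "E \<in> carrier (u_fin n)" "R \<in> u_inf_ge (n + 1)" "D = ladd u_inf E R"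
proof -
  obtain k where "D \<in> tri 1 k" using assms unfolding carrier_u_inf by blast
  then have "D \<in> tri 1 (n + k)" using tri_mono[of 1 1 k "n + k"] by auto
  then obtain p where p: "\<And>i. p i \<in> Pol (i - 1)" "D = (\<lambda>f. \<Sum>i=1..n+k. p i * pd i f)"
    by (elim triE) blast
  show thesis
  proof
    show "(\<lambda>f. \<Sum>i=1..n. p i * pd i f) \<in> carrier (u_fin n)"
      unfolding carrier_u_fin by (rule triI[OF p(1) refl])
    show "(\<lambda>f. \<Sum>i=n+1..n+k. p i * pd i f) \<in> u_inf_ge (n + 1)"
      unfolding u_inf_ge_def by (rule UN_I[OF UNIV_I], rule triI[OF p(1) refl])
    show "D = ladd u_inf (\<lambda>f. \<Sum>i=1..n. p i * pd i f) (\<lambda>f. \<Sum>i=n+1..n+k. p i * pd i f)"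
      unfolding u_inf_ops p(2) by (rule ext) (rule sum.ub_add_nat, simp)
  qed
qed

text \<open>Under the inclusion \<open>u\<^bsub>\<infinity>,n+1\<^esub> \<subseteq> I\<close> the reduced ideal is \<open>I \<inter> u\<^sub>n\<close>, and \<open>u\<^sub>\<infinity> = u\<^sub>n + I\<close>, so this is
  an instance of the second isomorphism theorem.\<close>

lemma quot_reduced_ideal:
  fixes I :: "('k::field pol \<Rightarrow> 'k pol) set"
  assumes I: "lie_ideal u_inf I" and n: "u_inf_ge (n + 1) \<subseteq> I"
  shows "lie_quot (u_fin n) (reduced_ideal n I) \<simeq>\<^sub>L lie_quot u_inf I"
proof -
  let ?F = "u_fin n :: ('k, _) lie_alg"
  have F: "u_inf\<lparr>carrier := carrier ?F\<rparr> = ?F" by (simp add: u_inf_def u_fin_def)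
  have "lie_quot (u_inf\<lparr>carrier := carrier ?F\<rparr>) (I \<inter> carrier ?F) \<simeq>\<^sub>L lie_quot u_inf I"
  proof (rule lie_quot_subalgebra[OF lie_algebra_u_inf I])
    show "lie_algebra (u_inf\<lparr>carrier := carrier ?F\<rparr>)" unfolding F by (rule lie_algebra_u_fin)
    show "carrier ?F \<subseteq> carrier u_inf" unfolding carrier_u_inf carrier_u_fin by blast
    show "lie_ideal (u_inf\<lparr>carrier := carrier ?F\<rparr>) (I \<inter> carrier ?F)"
      unfolding F reduced_ideal_eq[OF I n, symmetric] by (rule lie_ideal_reduced_ideal[OF I n])
    show "\<exists>s\<in>carrier ?F. \<exists>i\<in>I. x = ladd u_inf s i" if "x \<in> carrier u_inf" for x
      by (rule tri_split[OF that, of n]) (use n in blast)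
  qed
  then show ?thesis unfolding F reduced_ideal_eq[OF I n, symmetric] .
qed

lemma quot_isomorphic_iff_reduced:
  fixes I J :: "('k::field pol \<Rightarrow> 'k pol) set"
  assumes I: "lie_ideal u_inf I" "u_inf_ge (n + 1) \<subseteq> I"
    and J: "lie_ideal u_inf J" "u_inf_ge (n + 1) \<subseteq> J"
  shows "lie_quot u_inf I \<simeq>\<^sub>L lie_quot u_inf J \<longleftrightarrow>
    lie_quot (u_fin n) (reduced_ideal n I) \<simeq>\<^sub>L lie_quot (u_fin n) (reduced_ideal n J)"
proof -
  have red: "lie_algebra (lie_quot (u_fin n) (reduced_ideal n K))"
    if "lie_ideal u_inf K" "u_inf_ge (n + 1) \<subseteq> K" for K :: "('k pol \<Rightarrow> 'k pol) set"
    by (rule lie_algebra.lie_algebra_quot[OF lie_algebra_u_fin lie_ideal_reduced_ideal[OF that]])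
  note iso = quot_reduced_ideal[OF I] quot_reduced_ideal[OF J]
  note iso' = lie_isomorphic_sym[OF red[OF I] iso(1)] lie_isomorphic_sym[OF red[OF J] iso(2)]
  show ?thesis
    using lie_isomorphic_trans[OF lie_isomorphic_trans[OF iso(1)] iso'(2)]
      lie_isomorphic_trans[OF lie_isomorphic_trans[OF iso'(1)] iso(2)] by blast
qed

section \<open>Isomorphism classes of quotients\<close>

theorem corollary6p3:
  shows "(\<forall>I :: ('k::field_char_0 pol \<Rightarrow> 'k pol) set. lie_ideal u_inf I \<longrightarrow>
            (lie_quot u_inf I \<simeq>\<^sub>L (u_inf :: ('k, 'k pol \<Rightarrow> 'k pol) lie_alg) \<longleftrightarrow> I = {lzero u_inf})) \<and>
         (\<forall>I J :: ('k pol \<Rightarrow> 'k pol) set.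
            lie_ideal u_inf I \<and> lie_ideal u_inf J \<and> I \<noteq> {lzero u_inf} \<and> J \<noteq> {lzero u_inf} \<longrightarrow>
            (let N = {n'. n' \<ge> 2 \<and> u_inf_ge (n' + 1) \<subseteq> I \<and> u_inf_ge (n' + 1) \<subseteq> J};
                 n = (LEAST n'. n' \<in> N)
             in N \<noteq> {} \<and>
                (lie_quot u_inf I \<simeq>\<^sub>L lie_quot u_inf J \<longleftrightarrow>
                 lie_quot (u_fin n) (reduced_ideal n I) \<simeq>\<^sub>L lie_quot (u_fin n) (reduced_ideal n J))))"
proof (intro conjI allI impI)
  fix I :: "('k pol \<Rightarrow> 'k pol) set"
  assume "lie_ideal u_inf I"
  then show "lie_quot u_inf I \<simeq>\<^sub>L (u_inf :: ('k, 'k pol \<Rightarrow> 'k pol) lie_alg) \<longleftrightarrow> I = {lzero u_inf}"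
    using quot_nonzero_ideal_not_isomorphic lie_quot_zero_ideal[OF lie_algebra_u_inf] by blast
next
  fix I J :: "('k pol \<Rightarrow> 'k pol) set"
  assume IJ: "lie_ideal u_inf I \<and> lie_ideal u_inf J \<and> I \<noteq> {lzero u_inf} \<and> J \<noteq> {lzero u_inf}"
  define N where "N = {n'. n' \<ge> 2 \<and> u_inf_ge (n' + 1) \<subseteq> I \<and> u_inf_ge (n' + 1) \<subseteq> J}"
  define n where "n = (LEAST n'. n' \<in> N)"
  obtain k where k: "2 \<le> k" "u_inf_ge (k + 1) \<subseteq> I" using nonzero_ideal_contains_tail IJ by blast
  obtain l where l: "2 \<le> l" "u_inf_ge (l + 1) \<subseteq> J" using nonzero_ideal_contains_tail IJ by blast
  have "u_inf_ge (max k l + 1) \<subseteq> I" by (rule order_trans[OF u_inf_ge_mono k(2)]) simp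
  moreover have "u_inf_ge (max k l + 1) \<subseteq> J" by (rule order_trans[OF u_inf_ge_mono l(2)]) simp
  ultimately have "max k l \<in> N" using k(1) unfolding N_def by simp
  then have "n \<in> N" unfolding n_def by (rule LeastI)
  then have "lie_quot u_inf I \<simeq>\<^sub>L lie_quot u_inf J \<longleftrightarrow>
      lie_quot (u_fin n) (reduced_ideal n I) \<simeq>\<^sub>L lie_quot (u_fin n) (reduced_ideal n J)"
    using IJ unfolding N_def by (intro quot_isomorphic_iff_reduced) auto
  then show "let N = {n'. n' \<ge> 2 \<and> u_inf_ge (n' + 1) \<subseteq> I \<and> u_inf_ge (n' + 1) \<subseteq> J};
                 n = (LEAST n'. n' \<in> N)
             in N \<noteq> {} \<and>
                (lie_quot u_inf I \<simeq>\<^sub>L lie_quot u_inf J \<longleftrightarrow>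
                 lie_quot (u_fin n) (reduced_ideal n I) \<simeq>\<^sub>L lie_quot (u_fin n) (reduced_ideal n J))"
    unfolding Let_def N_def[symmetric] n_def[symmetric] using \<open>n \<in> N\<close> by (intro conjI) auto
qed

end
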